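(* Let $X$ be a path-connected ANR space, $R$ a ring, and let $H^*$ denote Alexander–Spanier cohomology. Suppose that $\alpha_i^*\in H^{k_i}(SP^2(X);R)$ with $k_i\ge 1$, for $i=1,2$. Let $\alpha_i\in H^{k_i}(X;R)$ be the image of $\alpha_i^*$ under the homomorphism $\partial_2^*$ induced by the diagonal map $\partial_2:X\to SP^2(X)$, and suppose $\alpha_1\smile\alpha_2\ne 0$. Then $\mathsf{icat}(X)\ge 2$.
   Context: $SP^2(X)$ is the orbit space of $X\times X$ under the action of the symmetric group $S_2$ permuting coordinates; $\partial_2(x)=[x,x]$. $I=[0,1]$. For a metric space $Z$ and $n\ge 1$, $\mathcal B_n(Z)$ is the space of probability measures on $Z$ whose support has at most $n$ points, written as finite formal convex combinations $\sum\lambda_z z$ with $\lambda_z>0$, $\sum\lambda_z=1$, equipped with the Lévy–Prokhorov metric; $\delta_z$ is the Dirac measure at $z$. $P(Z)$ is the space of continuous paths $I\to Z$ with the compact-open topology. Define $\Phi_n:\mathcal B_n(P(X))\to P(\mathcal B_n(X))$ by $\Phi_n(\sum\lambda_\alpha\alpha)(t)=\sum\lambda_\alpha\alpha(t)$. A path $f\in P(\mathcal B_n(X))$ is resolvable if $f=\Phi_n(\mu)$ for some $\mu\in\mathcal B_n(P(X))$; $RP(\mathcal B_n(X))\subset P(\mathcal B_n(X))$ is the subspace of resolvable paths. Given a basepoint $x_0\in X$, $RP_0(\mathcal B_k(X))=\{f\in RP(\mathcal B_k(X)) : f(1)=\delta_{x_0}\}$. $\mathsf{icat}(X)$ is the minimal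 integer $n\ge 0$ such that there is a continuous $H:X\to RP_0(\mathcal B_{n+1}(X))$ with $H(x)(0)=\delta_x$ for all $x\in X$ (infinite if no such $n$ exists). *)

theory Defs
  imports
    "HOL-Probability.Probability_Mass_Function"
    "HOL-Library.Uprod"
    "HOL-Library.Extended_Nat"
    "HOL-Library.Function_Algebras"
    "HOL-Algebra.Coset"
begin

section \<open>Absolute neighbourhood retracts\<close>

text \<open>
  A metrizable space \<open>X\<close> is an ANR if every closed embedded copy \<open>A\<close> of \<open>X\<close> in a metrizable space
  \<open>Y\<close> is a retract of a neighbourhood of \<open>A\<close> in \<open>Y\<close>. HOL cannot quantify over the type
  underlying \<open>Y\<close>; nothing is lost by taking it to be \<open>'a \<Rightarrow> real\<close>, because the
  Kuratowski-Wojdyslawski theorem embeds \<open>X\<close> as a closed subset of a convex set of bounded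
  real functions on \<open>X\<close>, and a neighbourhood retract of such a convex set is a neighbourhood
  retract in every metrizable space containing it as a closed subset (Dugundji). The library
  predicate \<open>ANR\<close> uses \<open>'a * real\<close> instead, which is adequate only for subsets of Euclidean
  spaces.
\<close>

definition ANR_space :: "'a topology \<Rightarrow> bool" where
  "ANR_space X \<longleftrightarrow> metrizable_space X \<and>
     (\<forall>(Y :: ('a \<Rightarrow> real) topology) A.
        metrizable_space Y \<and> closedin Y A \<and> X homeomorphic_space subtopology Y A \<longrightarrow>
        (\<exists>U. openin Y U \<and> A \<subseteq> U \<and> A retract_of_space subtopology Y U))"


section \<open>The symmetric square\<close>

definition quotient_topology :: "'a topology \<Rightarrow> ('a \<Rightarrow> 'b) \<Rightarrow> 'b topology" where
  "quotient_topology X f =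
     topology (\<lambda>U. U \<subseteq> f ` topspace X \<and> openin X {x \<in> topspace X. f x \<in> U})"

text \<open>
  \<^typ>\<open>'a uprod\<close> is the quotient of \<open>'a \<times> 'a\<close> by the swap, i.e. the set of orbits of \<open>S\<^sub>2\<close>,
  and \<^term>\<open>Upair x y\<close> is the orbit \<open>[x,y]\<close>.
\<close>

definition SP2 :: "'a topology \<Rightarrow> 'a uprod topology" where
  "SP2 X = quotient_topology (prod_topology X X) (\<lambda>(x, y). Upair x y)"

definition SP2_diagonal :: "'a \<Rightarrow> 'a uprod" where
  "SP2_diagonal x = Upair x x"

lemma openin_quotient_topology:
  "openin (quotient_topology X f) U \<longleftrightarrow> U \<subseteq> f ` topspace X \<and> openin X {x \<in> topspace X. f x \<in> U}"
proof -
  have "istopology (\<lambda>U. U \<subseteq> f ` topspace X \<and> openin X {x \<in> topspace X. f x \<in> U})"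
    unfolding istopology_def
  proof (intro conjI allI impI)
    fix U V assume U: "U \<subseteq> f ` topspace X \<and> openin X {x \<in> topspace X. f x \<in> U}"
      and V: "V \<subseteq> f ` topspace X \<and> openin X {x \<in> topspace X. f x \<in> V}"
    show "U \<inter> V \<subseteq> f ` topspace X" using U by blast
    have eq: "{x \<in> topspace X. f x \<in> U \<inter> V} = {x \<in> topspace X. f x \<in> U} \<inter> {x \<in> topspace X. f x \<in> V}"
      by blast
    show "openin X {x \<in> topspace X. f x \<in> U \<inter> V}"
      unfolding eq by (rule openin_Int) (use U V in blast)+
  next
    fix \<U> assume U: "\<forall>U\<in>\<U>. U \<subseteq> f ` topspace X \<and> openin X {x \<in> topspace X. f x \<in> U}"
    show "\<Union>\<U> \<subseteq> f ` topspace X" using U by (intro Union_least) blast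
    have eq: "{x \<in> topspace X. f x \<in> \<Union>\<U>} = (\<Union>U\<in>\<U>. {x \<in> topspace X. f x \<in> U})"
      by blast
    show "openin X {x \<in> topspace X. f x \<in> \<Union>\<U>}"
      unfolding eq by (rule openin_Union, erule imageE) (use U in blast)
  qed
  then show ?thesis unfolding quotient_topology_def by (simp add: topology_inverse')
qed

lemma topspace_quotient_topology: "topspace (quotient_topology X f) = f ` topspace X"
proof
  have "{x \<in> topspace X. f x \<in> f ` topspace X} = topspace X" by blast
  then have "openin (quotient_topology X f) (f ` topspace X)"
    by (simp add: openin_quotient_topology)
  then show "f ` topspace X \<subseteq> topspace (quotient_topology X f)"
    by (rule openin_subset)
  show "topspace (quotient_topology X f) \<subseteq> f ` topspace X"
    using openin_quotient_topology[of X f "topspace (quotient_topology X f)"] by simp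
qed

lemma quotient_map_quotient_topology: "quotient_map X (quotient_topology X f) f"
  unfolding quotient_map_def by (simp add: openin_quotient_topology topspace_quotient_topology)

lemma quotient_map_SP2: "quotient_map (prod_topology X X) (SP2 X) (\<lambda>(x, y). Upair x y)"
  unfolding SP2_def by (rule quotient_map_quotient_topology)

lemma continuous_map_SP2_diagonal: "continuous_map X (SP2 X) SP2_diagonal"
proof -
  have "continuous_map X (prod_topology X X) (\<lambda>x. (x, x))"
    by (intro continuous_map_pairedI) auto
  from continuous_map_compose[OF this quotient_imp_continuous_map[OF quotient_map_SP2]]
  show ?thesis by (simp add: o_def SP2_diagonal_def[abs_def])
qed


section \<open>Alexander-Spanier cohomology\<close>

text \<open>
  A \<open>q\<close>-cochain of \<open>X\<close> is an arbitrary function on \<open>(q+1)\<close>-tuples of points of \<open>X\<close>; tuples are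
  lists, and cochains are normalised to vanish on everything that is not a \<open>(q+1)\<close>-tuple in \<open>X\<close>,
  so that equality of cochains is equality of functions. The coefficients form an arbitrary ring,
  without further assumptions; this is why signs are written without the element 1.
\<close>

definition AS_simplices :: "nat \<Rightarrow> 'a topology \<Rightarrow> 'a list set" where
  "AS_simplices q X = {xs. length xs = Suc q \<and> set xs \<subseteq> topspace X}"

definition AS_cochains :: "nat \<Rightarrow> 'a topology \<Rightarrow> ('a list \<Rightarrow> 'r::ring) set" where
  "AS_cochains q X = {\<phi>. \<forall>xs. xs \<notin> AS_simplices q X \<longrightarrow> \<phi> xs = 0}"

definition AS_locally_zero :: "nat \<Rightarrow> 'a topology \<Rightarrow> ('a list \<Rightarrow> 'r::ring) set" where
  "AS_locally_zero q X = {\<phi> \<in> AS_cochains q X.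
     \<exists>\<U>. (\<forall>U\<in>\<U>. openin X U) \<and> \<Union>\<U> = topspace X \<and>
         (\<forall>U\<in>\<U>. \<forall>xs \<in> AS_simplices q X. set xs \<subseteq> U \<longrightarrow> \<phi> xs = 0)}"

definition del_nth :: "nat \<Rightarrow> 'a list \<Rightarrow> 'a list" where
  "del_nth i xs = take i xs @ drop (Suc i) xs"

definition AS_coboundary :: "nat \<Rightarrow> 'a topology \<Rightarrow> ('a list \<Rightarrow> 'r::ring) \<Rightarrow> 'a list \<Rightarrow> 'r" where
  "AS_coboundary q X \<phi> = (\<lambda>xs. if xs \<in> AS_simplices (Suc q) X
     then \<Sum>i\<le>Suc q. (if even i then \<phi> (del_nth i xs) else - \<phi> (del_nth i xs)) else 0)"

text \<open>
  The Alexander-Spanier complex is the quotient of the cochain complex by the subcomplex of locally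
  zero cochains. Its cocycles and coboundaries are described by their preimages \<open>Z\<^sup>q\<close> and \<open>B\<^sup>q\<close> in
  the cochain group, so that \<open>H\<^sup>q\<close> is the single quotient \<open>Z\<^sup>q / B\<^sup>q\<close>. There are no cochains in
  degree \<open>-1\<close>: the cohomology is not reduced.
\<close>

definition AS_cocycles :: "nat \<Rightarrow> 'a topology \<Rightarrow> ('a list \<Rightarrow> 'r::ring) set" where
  "AS_cocycles q X =
     {\<phi> \<in> AS_cochains q X. AS_coboundary q X \<phi> \<in> AS_locally_zero (Suc q) X}"

definition AS_coboundaries :: "nat \<Rightarrow> 'a topology \<Rightarrow> ('a list \<Rightarrow> 'r::ring) set" where
  "AS_coboundaries q X = (case q of
       0 \<Rightarrow> AS_locally_zero 0 X
     | Suc p \<Rightarrow> {AS_coboundary p X \<psi> + \<theta> | \<psi> \<theta>.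
                   \<psi> \<in> AS_cochains p X \<and> \<theta> \<in> AS_locally_zero (Suc p) X})"

definition AS_cocycle_group :: "nat \<Rightarrow> 'a topology \<Rightarrow> ('a list \<Rightarrow> 'r::ring) monoid" where
  "AS_cocycle_group q X =
     \<lparr>carrier = AS_cocycles q X, mult = (+), one = 0\<rparr>"

definition AS_cohomology :: "nat \<Rightarrow> 'a topology \<Rightarrow> ('a list \<Rightarrow> 'r::ring) set monoid" where
  "AS_cohomology q X = AS_cocycle_group q X Mod AS_coboundaries q X"

definition AS_class :: "nat \<Rightarrow> 'a topology \<Rightarrow> ('a list \<Rightarrow> 'r::ring) \<Rightarrow> ('a list \<Rightarrow> 'r) set" where
  "AS_class q X \<phi> = AS_coboundaries q X #>\<^bsub>AS_cocycle_group q X\<^esub> \<phi>"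

text \<open>
  Induced homomorphisms and cup products of cohomology classes are given by the cosets of
  \<open>B\<^sup>q\<close> swept out by the corresponding operations on all representatives; the lemmas
  \<open>AS_induced_class\<close> and \<open>AS_cup_class\<close> below are the usual formulas in terms of one representative.
\<close>

definition AS_pullback ::
    "nat \<Rightarrow> 'a topology \<Rightarrow> ('a \<Rightarrow> 'b) \<Rightarrow> ('b list \<Rightarrow> 'r::ring) \<Rightarrow> 'a list \<Rightarrow> 'r" where
  "AS_pullback q X f \<phi> = (\<lambda>xs. if xs \<in> AS_simplices q X then \<phi> (map f xs) else 0)"

definition AS_induced ::
    "nat \<Rightarrow> 'a topology \<Rightarrow> ('a \<Rightarrow> 'b) \<Rightarrow> ('b list \<Rightarrow> 'r::ring) set \<Rightarrow> ('a list \<Rightarrow> 'r) set" where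
  "AS_induced q X f K = (\<Union>\<phi>\<in>K. AS_class q X (AS_pullback q X f \<phi>))"

definition AS_cochain_cup ::
    "nat \<Rightarrow> nat \<Rightarrow> 'a topology \<Rightarrow> ('a list \<Rightarrow> 'r::ring) \<Rightarrow> ('a list \<Rightarrow> 'r) \<Rightarrow> 'a list \<Rightarrow> 'r" where
  "AS_cochain_cup p q X \<phi> \<psi> = (\<lambda>xs. if xs \<in> AS_simplices (p + q) X
     then \<phi> (take (Suc p) xs) * \<psi> (drop p xs) else 0)"

definition AS_cup :: "nat \<Rightarrow> nat \<Rightarrow> 'a topology \<Rightarrow>
    ('a list \<Rightarrow> 'r::ring) set \<Rightarrow> ('a list \<Rightarrow> 'r) set \<Rightarrow> ('a list \<Rightarrow> 'r) set" where
  "AS_cup p q X K L = (\<Union>\<phi>\<in>K. \<Union>\<psi>\<in>L. AS_class (p + q) X (AS_cochain_cup p q X \<phi> \<psi>))"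


subsection \<open>Cochains\<close>

lemma length_del_nth [simp]: "i < length xs \<Longrightarrow> length (del_nth i xs) = length xs - 1"
  by (simp add: del_nth_def)

lemma set_del_nth: "set (del_nth i xs) \<subseteq> set xs"
  unfolding del_nth_def using set_take_subset[of i xs] set_drop_subset[of "Suc i" xs] by auto

lemma map_del_nth: "map f (del_nth i xs) = del_nth i (map f xs)"
  by (simp add: del_nth_def take_map drop_map)

lemma del_nth_Cons_0 [simp]: "del_nth 0 (x # xs) = xs"
  by (simp add: del_nth_def)

lemma del_nth_Cons_Suc [simp]: "del_nth (Suc i) (x # xs) = x # del_nth i xs"
  by (simp add: del_nth_def)

lemma del_nth_del_nth:
  "i \<le> j \<Longrightarrow> Suc j < length xs \<Longrightarrow> del_nth i (del_nth (Suc j) xs) = del_nth j (del_nth i xs)"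
proof (induction xs arbitrary: i j)
  case Nil
  then show ?case by simp
next
  case (Cons x xs)
  show ?case
  proof (cases i)
    case 0
    then show ?thesis using Cons.prems
      by (cases j) (auto simp: neq_Nil_conv)
  next
    case (Suc i')
    then obtain j' where j: "j = Suc j'" using Cons.prems by (cases j) auto
    then show ?thesis using Suc Cons by simp
  qed
qed

lemma del_nth_AS_simplices:
  "xs \<in> AS_simplices (Suc q) X \<Longrightarrow> i \<le> Suc q \<Longrightarrow> del_nth i xs \<in> AS_simplices q X"
  using set_del_nth[of i xs] by (auto simp: AS_simplices_def)

lemma AS_cochainsI: "(\<And>xs. xs \<notin> AS_simplices q X \<Longrightarrow> \<phi> xs = 0) \<Longrightarrow> \<phi> \<in> AS_cochains q X"
  by (simp add: AS_cochains_def)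

lemma AS_cochains_eq_0: "\<phi> \<in> AS_cochains q X \<Longrightarrow> xs \<notin> AS_simplices q X \<Longrightarrow> \<phi> xs = 0"
  by (simp add: AS_cochains_def)

lemma AS_cochains_zero: "0 \<in> AS_cochains q X"
  and AS_cochains_add: "\<phi> \<in> AS_cochains q X \<Longrightarrow> \<psi> \<in> AS_cochains q X \<Longrightarrow> \<phi> + \<psi> \<in> AS_cochains q X"
  and AS_cochains_uminus: "\<phi> \<in> AS_cochains q X \<Longrightarrow> - \<phi> \<in> AS_cochains q X"
  by (simp_all add: AS_cochains_def)

lemma AS_locally_zero_cochain: "\<phi> \<in> AS_locally_zero q X \<Longrightarrow> \<phi> \<in> AS_cochains q X"
  by (simp add: AS_locally_zero_def)

lemma AS_locally_zeroI:
  assumes "\<phi> \<in> AS_cochains q X" "\<And>x. x \<in> topspace X \<Longrightarrow> \<exists>U. openin X U \<and> x \<in> U \<and>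
     (\<forall>xs \<in> AS_simplices q X. set xs \<subseteq> U \<longrightarrow> \<phi> xs = 0)"
  shows "\<phi> \<in> AS_locally_zero q X"
proof -
  let ?\<U> = "{U. openin X U \<and> (\<forall>xs \<in> AS_simplices q X. set xs \<subseteq> U \<longrightarrow> \<phi> xs = 0)}"
  have "topspace X \<subseteq> \<Union>?\<U>"
  proof
    fix x assume "x \<in> topspace X"
    from assms(2)[OF this] show "x \<in> \<Union>?\<U>" by blast
  qed
  moreover have "\<Union>?\<U> \<subseteq> topspace X" by (auto dest: openin_subset)
  ultimately have "\<Union>?\<U> = topspace X" by blast
  then show ?thesis
    unfolding AS_locally_zero_def using assms(1)
    by (intro CollectI conjI exI[of _ ?\<U>]) auto
qed

lemma AS_locally_zeroD:
  assumes "\<phi> \<in> AS_locally_zero q X" "x \<in> topspace X"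
  obtains U where "openin X U" "x \<in> U" "\<And>xs. set xs \<subseteq> U \<Longrightarrow> \<phi> xs = 0"
proof -
  obtain \<U> where \<U>: "\<forall>U\<in>\<U>. openin X U" "\<Union>\<U> = topspace X"
     "\<forall>U\<in>\<U>. \<forall>xs \<in> AS_simplices q X. set xs \<subseteq> U \<longrightarrow> \<phi> xs = 0"
    using assms(1) by (auto simp: AS_locally_zero_def)
  obtain U where U: "U \<in> \<U>" "x \<in> U" using \<U>(2) assms(2) by blast
  show thesis
  proof
    show "openin X U" "x \<in> U" using \<U>(1) U by auto
    fix xs assume "set xs \<subseteq> U"
    then show "\<phi> xs = 0"
      using \<U>(3) U(1) AS_cochains_eq_0[OF AS_locally_zero_cochain[OF assms(1)]] by blast
  qed
qed

lemma AS_locally_zero_zero: "0 \<in> AS_locally_zero q X"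
  by (rule AS_locally_zeroI[OF AS_cochains_zero]) auto

lemma AS_locally_zero_uminus: "\<phi> \<in> AS_locally_zero q X \<Longrightarrow> - \<phi> \<in> AS_locally_zero q X"
  by (simp add: AS_locally_zero_def AS_cochains_def)

lemma AS_locally_zero_add:
  assumes "\<phi> \<in> AS_locally_zero q X" "\<psi> \<in> AS_locally_zero q X"
  shows "\<phi> + \<psi> \<in> AS_locally_zero q X"
proof (rule AS_locally_zeroI)
  show "\<phi> + \<psi> \<in> AS_cochains q X" using assms by (simp add: AS_cochains_add AS_locally_zero_cochain)
next
  fix x assume x: "x \<in> topspace X"
  obtain U where U: "openin X U" "x \<in> U" "\<And>xs. set xs \<subseteq> U \<Longrightarrow> \<phi> xs = 0"
    using AS_locally_zeroD[OF assms(1) x] by blast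
  obtain V where V: "openin X V" "x \<in> V" "\<And>xs. set xs \<subseteq> V \<Longrightarrow> \<psi> xs = 0"
    using AS_locally_zeroD[OF assms(2) x] by blast
  show "\<exists>U. openin X U \<and> x \<in> U \<and> (\<forall>xs \<in> AS_simplices q X. set xs \<subseteq> U \<longrightarrow> (\<phi> + \<psi>) xs = 0)"
    using U V by (intro exI[of _ "U \<inter> V"]) auto
qed

lemma AS_coboundary_cochain: "AS_coboundary q X \<phi> \<in> AS_cochains (Suc q) X"
  by (simp add: AS_coboundary_def AS_cochains_def)

lemma AS_coboundary_add:
  "AS_coboundary q X (\<phi> + \<psi>) = AS_coboundary q X \<phi> + AS_coboundary q X \<psi>"
  by (auto simp: AS_coboundary_def fun_eq_iff simp flip: sum.distrib intro!: sum.cong)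

lemma AS_coboundary_uminus: "AS_coboundary q X (- \<phi>) = - AS_coboundary q X \<phi>"
  by (auto simp: AS_coboundary_def fun_eq_iff simp flip: sum_negf intro!: sum.cong)

lemma AS_coboundary_zero: "AS_coboundary q X 0 = 0"
  by (auto simp: AS_coboundary_def fun_eq_iff simp del: sum.atMost_Suc intro!: sum.neutral)

lemma AS_coboundary_locally_zero:
  assumes "\<phi> \<in> AS_locally_zero q X"
  shows "AS_coboundary q X \<phi> \<in> AS_locally_zero (Suc q) X"
proof (rule AS_locally_zeroI[OF AS_coboundary_cochain])
  fix x assume x: "x \<in> topspace X"
  obtain U where U: "openin X U" "x \<in> U" "\<And>xs. set xs \<subseteq> U \<Longrightarrow> \<phi> xs = 0"
    using AS_locally_zeroD[OF assms x] by blast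
  have "AS_coboundary q X \<phi> xs = 0" if "set xs \<subseteq> U" for xs
  proof -
    have "\<phi> (del_nth i xs) = 0" for i using U(3) set_del_nth[of i xs] that by blast
    then show ?thesis by (auto simp: AS_coboundary_def simp del: sum.atMost_Suc intro!: sum.neutral)
  qed
  then show "\<exists>U. openin X U \<and> x \<in> U \<and>
      (\<forall>xs \<in> AS_simplices (Suc q) X. set xs \<subseteq> U \<longrightarrow> AS_coboundary q X \<phi> xs = 0)"
    using U(1,2) by blast
qed

lemma AS_coboundary_coboundary:
  fixes \<phi> :: "'a list \<Rightarrow> 'r::ring"
  shows "AS_coboundary (Suc q) X (AS_coboundary q X \<phi>) = 0"
proof
  fix xs
  show "AS_coboundary (Suc q) X (AS_coboundary q X \<phi>) xs = 0 xs"
  proof (cases "xs \<in> AS_simplices (Suc (Suc q)) X")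
    case False
    then show ?thesis by (simp add: AS_coboundary_def)
  next
    case xs: True
    then have len: "length xs = Suc (Suc (Suc q))" by (simp add: AS_simplices_def)
    define T where "T = (\<lambda>(i, j). (if even (i + j) then \<phi> (del_nth j (del_nth i xs))
                                    else - \<phi> (del_nth j (del_nth i xs))))"
    have "AS_coboundary (Suc q) X (AS_coboundary q X \<phi>) xs =
        (\<Sum>i\<le>Suc (Suc q). \<Sum>j\<le>Suc q. T (i, j))"
    proof -
      have "(if even i then AS_coboundary q X \<phi> (del_nth i xs) else - AS_coboundary q X \<phi> (del_nth i xs))
          = (\<Sum>j\<le>Suc q. T (i, j))" if "i \<le> Suc (Suc q)" for i
        using del_nth_AS_simplices[OF xs that]
        by (auto simp: AS_coboundary_def T_def simp del: sum.atMost_Suc simp flip: sum_negf intro!: sum.cong)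
      then show ?thesis using xs by (subst AS_coboundary_def) (auto simp del: sum.atMost_Suc intro!: sum.cong)
    qed
    also have "\<dots> = sum T ({..Suc (Suc q)} \<times> {..Suc q})"
      by (simp add: sum.cartesian_product del: sum.atMost_Suc)
    also have "\<dots> = sum T {(i, j). i \<le> Suc (Suc q) \<and> j < i} + sum T {(i, j). j \<le> Suc q \<and> i \<le> j}"
    proof (subst sum.union_disjoint[symmetric])
      have fin: "finite ({..Suc (Suc q)} \<times> {..Suc q})" by simp
      show "finite {(i, j). i \<le> Suc (Suc q) \<and> j < i}" by (rule finite_subset[OF _ fin]) auto
      show "finite {(i, j). j \<le> Suc q \<and> i \<le> j}" by (rule finite_subset[OF _ fin]) auto
      show "{(i, j). i \<le> Suc (Suc q) \<and> j < i} \<inter> {(i, j). j \<le> Suc q \<and> i \<le> j} = {}" by auto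
      have "{..Suc (Suc q)} \<times> {..Suc q} =
          {(i, j). i \<le> Suc (Suc q) \<and> j < i} \<union> {(i, j). j \<le> Suc q \<and> i \<le> j}" by auto
      then show "sum T ({..Suc (Suc q)} \<times> {..Suc q}) =
          sum T ({(i, j). i \<le> Suc (Suc q) \<and> j < i} \<union> {(i, j). j \<le> Suc q \<and> i \<le> j})" by simp
    qed
    also have "sum T {(i, j). i \<le> Suc (Suc q) \<and> j < i} =
        (\<Sum>p | p \<in> {(i, j). j \<le> Suc q \<and> i \<le> j}. - T p)"
    proof (rule sum.reindex_bij_witness[of _ "\<lambda>(i, j). (Suc j, i)" "\<lambda>(i, j). (j, i - 1)"], goal_cases)
      case (5 p)
      then obtain i j where p: "p = (Suc i, j)" "i \<le> Suc q" "j \<le> i"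
        by (cases p; cases "fst p") auto
      have "del_nth j (del_nth (Suc i) xs) = del_nth i (del_nth j xs)"
        using p len by (intro del_nth_del_nth) auto
      then show ?case using p by (auto simp: T_def)
    qed auto
    finally show ?thesis by (simp add: sum_negf)
  qed
qed

subsection \<open>The group of cohomology classes\<close>

lemma AS_cocycles_zero: "0 \<in> AS_cocycles q X"
  by (simp add: AS_cocycles_def AS_cochains_zero AS_coboundary_zero AS_locally_zero_zero)

lemma AS_cocycles_add:
  "\<phi> \<in> AS_cocycles q X \<Longrightarrow> \<psi> \<in> AS_cocycles q X \<Longrightarrow> \<phi> + \<psi> \<in> AS_cocycles q X"
  by (simp add: AS_cocycles_def AS_cochains_add AS_coboundary_add AS_locally_zero_add)

lemma AS_cocycles_uminus: "\<phi> \<in> AS_cocycles q X \<Longrightarrow> - \<phi> \<in> AS_cocycles q X"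
  by (simp add: AS_cocycles_def AS_cochains_uminus AS_coboundary_uminus AS_locally_zero_uminus)

lemma AS_coboundaries_SucI:
  "\<psi> \<in> AS_cochains p X \<Longrightarrow> \<theta> \<in> AS_locally_zero (Suc p) X \<Longrightarrow>
    AS_coboundary p X \<psi> + \<theta> \<in> AS_coboundaries (Suc p) X"
  unfolding AS_coboundaries_def by auto

lemma AS_locally_zero_coboundaries: "\<phi> \<in> AS_locally_zero q X \<Longrightarrow> \<phi> \<in> AS_coboundaries q X"
proof (cases q)
  case (Suc p)
  assume "\<phi> \<in> AS_locally_zero q X"
  then show ?thesis
    using Suc AS_coboundaries_SucI[OF AS_cochains_zero, of \<phi> p X] by (simp add: AS_coboundary_zero)
qed (simp add: AS_coboundaries_def)

lemma AS_coboundary_coboundaries: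
  "\<psi> \<in> AS_cochains q X \<Longrightarrow> AS_coboundary q X \<psi> \<in> AS_coboundaries (Suc q) X"
  using AS_coboundaries_SucI[OF _ AS_locally_zero_zero, of \<psi> q X] by simp

lemma AS_coboundariesE:
  assumes "\<beta> \<in> AS_coboundaries q X"
  obtains "\<beta> \<in> AS_locally_zero q X"
  | p \<psi> \<theta> where "q = Suc p" "\<psi> \<in> AS_cochains p X" "\<theta> \<in> AS_locally_zero q X"
      "\<beta> = AS_coboundary p X \<psi> + \<theta>"
  using assms by (cases q) (auto simp: AS_coboundaries_def)

lemma AS_coboundaries_add:
  assumes "\<beta> \<in> AS_coboundaries q X" "\<gamma> \<in> AS_coboundaries q X"
  shows "\<beta> + \<gamma> \<in> AS_coboundaries q X"
proof (cases q)
  case 0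
  then show ?thesis using assms by (simp add: AS_coboundaries_def AS_locally_zero_add)
next
  case (Suc p)
  obtain \<psi> \<theta> where 1: "\<psi> \<in> AS_cochains p X" "\<theta> \<in> AS_locally_zero q X" "\<beta> = AS_coboundary p X \<psi> + \<theta>"
    using assms(1) Suc by (auto simp: AS_coboundaries_def)
  obtain \<psi>' \<theta>' where 2: "\<psi>' \<in> AS_cochains p X" "\<theta>' \<in> AS_locally_zero q X" "\<gamma> = AS_coboundary p X \<psi>' + \<theta>'"
    using assms(2) Suc by (auto simp: AS_coboundaries_def)
  have "\<beta> + \<gamma> = AS_coboundary p X (\<psi> + \<psi>') + (\<theta> + \<theta>')"
    by (simp add: 1 2 AS_coboundary_add add_ac)
  also have "\<dots> \<in> AS_coboundaries (Suc p) X"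
    using 1 2 Suc by (intro AS_coboundaries_SucI AS_cochains_add AS_locally_zero_add) auto
  finally show ?thesis using Suc by simp
qed

lemma AS_coboundaries_uminus:
  assumes "\<beta> \<in> AS_coboundaries q X" shows "- \<beta> \<in> AS_coboundaries q X"
  using assms
proof (cases rule: AS_coboundariesE)
  case 1
  then show ?thesis by (simp add: AS_locally_zero_coboundaries AS_locally_zero_uminus)
next
  case (2 p \<psi> \<theta>)
  have "- \<beta> = AS_coboundary p X (- \<psi>) + (- \<theta>)" by (simp add: 2 AS_coboundary_uminus)
  then show ?thesis
    unfolding 2(1)
    using 2 AS_coboundaries_add[OF AS_coboundary_coboundaries AS_locally_zero_coboundaries]
      AS_cochains_uminus AS_locally_zero_uminus by metis
qed

lemma AS_coboundaries_cocycles: "AS_coboundaries q X \<subseteq> AS_cocycles q X"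
proof
  fix \<beta> :: "'a list \<Rightarrow> 'r::ring" assume "\<beta> \<in> AS_coboundaries q X"
  then show "\<beta> \<in> AS_cocycles q X"
  proof (cases rule: AS_coboundariesE)
    case 1
    then show ?thesis
      by (simp add: AS_cocycles_def AS_locally_zero_cochain AS_coboundary_locally_zero)
  next
    case (2 p \<psi> \<theta>)
    then have "AS_coboundary q X \<beta> = AS_coboundary q X \<theta>"
      by (simp add: AS_coboundary_add AS_coboundary_coboundary)
    then show ?thesis using 2
      by (simp add: AS_cocycles_def AS_locally_zero_cochain AS_coboundary_locally_zero
          AS_cochains_add AS_coboundary_cochain)
  qed
qed

lemma AS_cocycle_group_simps [simp]:
  "carrier (AS_cocycle_group q X) = AS_cocycles q X"
  "x \<otimes>\<^bsub>AS_cocycle_group q X\<^esub> y = x + y"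
  "\<one>\<^bsub>AS_cocycle_group q X\<^esub> = 0"
  by (simp_all add: AS_cocycle_group_def)

lemma comm_group_AS_cocycle_group: "comm_group (AS_cocycle_group q X)"
proof (rule comm_groupI)
  fix x assume "x \<in> carrier (AS_cocycle_group q X)"
  then show "\<exists>y\<in>carrier (AS_cocycle_group q X). y \<otimes>\<^bsub>AS_cocycle_group q X\<^esub> x = \<one>\<^bsub>AS_cocycle_group q X\<^esub>"
    by (intro bexI[of _ "- x"]) (auto simp: AS_cocycles_uminus)
qed (auto simp: AS_cocycles_add AS_cocycles_zero add_ac)

lemma subgroup_AS_coboundaries: "subgroup (AS_coboundaries q X) (AS_cocycle_group q X)"
proof -
  interpret comm_group "AS_cocycle_group q X" by (rule comm_group_AS_cocycle_group)
  show ?thesis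
  proof (rule subgroupI)
    show "AS_coboundaries q X \<subseteq> carrier (AS_cocycle_group q X)"
      by (simp add: AS_coboundaries_cocycles)
    show "AS_coboundaries q X \<noteq> {}"
      using AS_locally_zero_coboundaries[OF AS_locally_zero_zero] by blast
  next
    fix \<beta> assume b: "\<beta> \<in> AS_coboundaries q X"
    then have "inv\<^bsub>AS_cocycle_group q X\<^esub> \<beta> = - \<beta>"
      using AS_coboundaries_cocycles[of q X] by (intro inv_equality) (auto simp: AS_cocycles_uminus)
    then show "inv\<^bsub>AS_cocycle_group q X\<^esub> \<beta> \<in> AS_coboundaries q X"
      using b by (simp add: AS_coboundaries_uminus)
  qed (simp add: AS_coboundaries_add)
qed

lemma comm_group_AS_cohomology: "comm_group (AS_cohomology q X)"
  unfolding AS_cohomology_def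
  by (rule comm_group.abelian_FactGroup[OF comm_group_AS_cocycle_group subgroup_AS_coboundaries])

lemma mem_AS_class: "\<phi>' \<in> AS_class q X \<phi> \<longleftrightarrow> \<phi>' - \<phi> \<in> AS_coboundaries q X"
proof -
  have "\<phi>' \<in> AS_class q X \<phi> \<longleftrightarrow> (\<exists>\<beta>\<in>AS_coboundaries q X. \<phi>' = \<beta> + \<phi>)"
    by (simp add: AS_class_def r_coset_def)
  also have "\<dots> \<longleftrightarrow> \<phi>' - \<phi> \<in> AS_coboundaries q X"
    by (metis add_diff_cancel diff_add_cancel)
  finally show ?thesis .
qed

lemma AS_class_self: "\<phi> \<in> AS_class q X \<phi>"
  by (simp add: mem_AS_class AS_locally_zero_coboundaries AS_locally_zero_zero)

lemma AS_class_eq: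
  assumes "\<phi>' - \<phi> \<in> AS_coboundaries q X"
  shows "AS_class q X \<phi>' = AS_class q X \<phi>"
proof -
  have "\<rho> - \<phi>' \<in> AS_coboundaries q X \<longleftrightarrow> \<rho> - \<phi> \<in> AS_coboundaries q X" for \<rho>
  proof
    assume "\<rho> - \<phi>' \<in> AS_coboundaries q X"
    from AS_coboundaries_add[OF this assms] show "\<rho> - \<phi> \<in> AS_coboundaries q X" by simp
  next
    assume "\<rho> - \<phi> \<in> AS_coboundaries q X"
    from AS_coboundaries_add[OF this AS_coboundaries_uminus[OF assms]]
    show "\<rho> - \<phi>' \<in> AS_coboundaries q X" by simp
  qed
  then show ?thesis by (auto simp: mem_AS_class)
qed

lemma carrier_AS_cohomology: "carrier (AS_cohomology q X) = AS_class q X ` AS_cocycles q X"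
  by (simp add: AS_cohomology_def AS_class_def[abs_def] carrier_FactGroup)

lemma one_AS_cohomology: "\<one>\<^bsub>AS_cohomology q X\<^esub> = AS_coboundaries q X"
  by (simp add: AS_cohomology_def)

subsection \<open>Induced homomorphisms\<close>

lemma AS_pullback_cochain: "AS_pullback q X f \<phi> \<in> AS_cochains q X"
  by (simp add: AS_pullback_def AS_cochains_def)

lemma map_AS_simplices:
  "continuous_map X Y f \<Longrightarrow> xs \<in> AS_simplices q X \<Longrightarrow> map f xs \<in> AS_simplices q Y"
  unfolding AS_simplices_def using continuous_map_image_subset_topspace[of X Y f] by auto

lemma AS_pullback_coboundary:
  assumes "continuous_map X Y f"
  shows "AS_pullback (Suc q) X f (AS_coboundary q Y \<phi>) = AS_coboundary q X (AS_pullback q X f \<phi>)"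
proof
  fix xs
  show "AS_pullback (Suc q) X f (AS_coboundary q Y \<phi>) xs = AS_coboundary q X (AS_pullback q X f \<phi>) xs"
    using map_AS_simplices[OF assms, of xs "Suc q"] del_nth_AS_simplices[of xs q X]
    by (auto simp: AS_pullback_def AS_coboundary_def map_del_nth simp del: sum.atMost_Suc intro!: sum.cong)
qed

lemma AS_pullback_locally_zero:
  assumes "continuous_map X Y f" "\<phi> \<in> AS_locally_zero q Y"
  shows "AS_pullback q X f \<phi> \<in> AS_locally_zero q X"
proof (rule AS_locally_zeroI[OF AS_pullback_cochain])
  fix x assume x: "x \<in> topspace X"
  then have "f x \<in> topspace Y" using continuous_map_image_subset_topspace[OF assms(1)] by blast
  then obtain U where U: "openin Y U" "f x \<in> U" "\<And>xs. set xs \<subseteq> U \<Longrightarrow> \<phi> xs = 0"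
    using AS_locally_zeroD[OF assms(2)] by blast
  let ?V = "{x \<in> topspace X. f x \<in> U}"
  have "openin X ?V" using openin_continuous_map_preimage[OF assms(1) U(1)] .
  moreover have "AS_pullback q X f \<phi> xs = 0" if "set xs \<subseteq> ?V" for xs
    using U(3)[of "map f xs"] that by (auto simp: AS_pullback_def)
  ultimately show "\<exists>U. openin X U \<and> x \<in> U \<and>
      (\<forall>xs \<in> AS_simplices q X. set xs \<subseteq> U \<longrightarrow> AS_pullback q X f \<phi> xs = 0)"
    using x U(2) by (intro exI[of _ ?V]) auto
qed

lemma AS_pullback_add: "AS_pullback q X f (\<phi> + \<psi>) = AS_pullback q X f \<phi> + AS_pullback q X f \<psi>"
  and AS_pullback_diff: "AS_pullback q X f (\<phi> - \<psi>) = AS_pullback q X f \<phi> - AS_pullback q X f \<psi>"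
  by (auto simp: AS_pullback_def fun_eq_iff)

lemma AS_pullback_cocycle:
  assumes "continuous_map X Y f" "\<phi> \<in> AS_cocycles q Y"
  shows "AS_pullback q X f \<phi> \<in> AS_cocycles q X"
  using assms AS_pullback_locally_zero[OF assms(1), of "AS_coboundary q Y \<phi>" "Suc q"]
  by (simp add: AS_cocycles_def AS_pullback_cochain AS_pullback_coboundary)

lemma AS_pullback_coboundaries:
  assumes "continuous_map X Y f" "\<beta> \<in> AS_coboundaries q Y"
  shows "AS_pullback q X f \<beta> \<in> AS_coboundaries q X"
  using assms(2)
proof (cases rule: AS_coboundariesE)
  case 1
  then show ?thesis by (simp add: AS_pullback_locally_zero[OF assms(1)] AS_locally_zero_coboundaries)
next
  case (2 p \<psi> \<theta>)
  then show ?thesis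
    by (simp add: AS_pullback_add AS_pullback_coboundary[OF assms(1)] AS_coboundaries_add
        AS_coboundary_coboundaries AS_pullback_cochain AS_locally_zero_coboundaries
        AS_pullback_locally_zero[OF assms(1)])
qed

lemma AS_induced_class:
  assumes "continuous_map X Y f"
  shows "AS_induced q X f (AS_class q Y \<phi>) = AS_class q X (AS_pullback q X f \<phi>)"
proof -
  have "AS_class q X (AS_pullback q X f \<phi>') = AS_class q X (AS_pullback q X f \<phi>)"
    if "\<phi>' \<in> AS_class q Y \<phi>" for \<phi>'
    using that AS_pullback_coboundaries[OF assms]
    by (intro AS_class_eq) (auto simp: mem_AS_class simp flip: AS_pullback_diff)
  then show ?thesis unfolding AS_induced_def using AS_class_self[of \<phi> q Y] by blast
qed

subsection \<open>Cup products\<close>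

lemma AS_cochain_cup_cochain: "AS_cochain_cup p q X \<phi> \<psi> \<in> AS_cochains (p + q) X"
  by (simp add: AS_cochain_cup_def AS_cochains_def)

lemma AS_cochain_cup_add_left:
    "AS_cochain_cup p q X (\<phi> + \<phi>') \<psi> = AS_cochain_cup p q X \<phi> \<psi> + AS_cochain_cup p q X \<phi>' \<psi>"
  and AS_cochain_cup_add_right:
    "AS_cochain_cup p q X \<phi> (\<psi> + \<psi>') = AS_cochain_cup p q X \<phi> \<psi> + AS_cochain_cup p q X \<phi> \<psi>'"
  by (auto simp: AS_cochain_cup_def fun_eq_iff distrib_left distrib_right)

lemma AS_cochain_cup_locally_zero_left:
  assumes "\<phi> \<in> AS_locally_zero p X"
  shows "AS_cochain_cup p q X \<phi> \<psi> \<in> AS_locally_zero (p + q) X"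
proof (rule AS_locally_zeroI[OF AS_cochain_cup_cochain])
  fix x assume x: "x \<in> topspace X"
  obtain U where U: "openin X U" "x \<in> U" "\<And>xs. set xs \<subseteq> U \<Longrightarrow> \<phi> xs = 0"
    using AS_locally_zeroD[OF assms x] by blast
  have "AS_cochain_cup p q X \<phi> \<psi> xs = 0" if "set xs \<subseteq> U" for xs
    using U(3)[of "take (Suc p) xs"] set_take_subset[of "Suc p" xs] that
    by (auto simp: AS_cochain_cup_def)
  then show "\<exists>U. openin X U \<and> x \<in> U \<and>
      (\<forall>xs \<in> AS_simplices (p + q) X. set xs \<subseteq> U \<longrightarrow> AS_cochain_cup p q X \<phi> \<psi> xs = 0)"
    using U(1,2) by blast
qed

lemma AS_cochain_cup_locally_zero_right:
  assumes "\<psi> \<in> AS_locally_zero q X"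
  shows "AS_cochain_cup p q X \<phi> \<psi> \<in> AS_locally_zero (p + q) X"
proof (rule AS_locally_zeroI[OF AS_cochain_cup_cochain])
  fix x assume x: "x \<in> topspace X"
  obtain U where U: "openin X U" "x \<in> U" "\<And>xs. set xs \<subseteq> U \<Longrightarrow> \<psi> xs = 0"
    using AS_locally_zeroD[OF assms x] by blast
  have "AS_cochain_cup p q X \<phi> \<psi> xs = 0" if "set xs \<subseteq> U" for xs
    using U(3)[of "drop p xs"] set_drop_subset[of p xs] that
    by (auto simp: AS_cochain_cup_def)
  then show "\<exists>U. openin X U \<and> x \<in> U \<and>
      (\<forall>xs \<in> AS_simplices (p + q) X. set xs \<subseteq> U \<longrightarrow> AS_cochain_cup p q X \<phi> \<psi> xs = 0)"
    using U(1,2) by blast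
qed

lemma AS_coboundary_cup:
  fixes \<phi> \<psi> :: "'a list \<Rightarrow> 'r::ring"
  shows "AS_coboundary (p + q) X (AS_cochain_cup p q X \<phi> \<psi>) =
     AS_cochain_cup (Suc p) q X (AS_coboundary p X \<phi>) \<psi> +
     (if even p then AS_cochain_cup p (Suc q) X \<phi> (AS_coboundary q X \<psi>)
      else - AS_cochain_cup p (Suc q) X \<phi> (AS_coboundary q X \<psi>))"
proof
  fix xs
  let ?s = "\<lambda>i (x::'r). if even (i::nat) then x else - x"
  show "AS_coboundary (p + q) X (AS_cochain_cup p q X \<phi> \<psi>) xs = (
     AS_cochain_cup (Suc p) q X (AS_coboundary p X \<phi>) \<psi> +
     (if even p then AS_cochain_cup p (Suc q) X \<phi> (AS_coboundary q X \<psi>)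
      else - AS_cochain_cup p (Suc q) X \<phi> (AS_coboundary q X \<psi>))) xs"
  proof (cases "xs \<in> AS_simplices (Suc (p + q)) X")
    case False
    then show ?thesis by (auto simp: AS_coboundary_def AS_cochain_cup_def)
  next
    case xs: True
    then have len: "length xs = Suc (Suc (p + q))" by (simp add: AS_simplices_def)
    define F where "F = (\<lambda>i. ?s i (\<phi> (del_nth i (take (Suc (Suc p)) xs)) * \<psi> (drop (Suc p) xs)))"
    define G where "G = (\<lambda>i. ?s (i + p) (\<phi> (take (Suc p) xs) * \<psi> (del_nth i (drop p xs))))"
    have t: "take (Suc (Suc p)) xs \<in> AS_simplices (Suc p) X"
      using xs set_take_subset[of "Suc (Suc p)" xs] by (auto simp: AS_simplices_def)
    have d: "drop p xs \<in> AS_simplices (Suc q) X"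
      using xs set_drop_subset[of p xs] by (auto simp: AS_simplices_def)
    have L: "AS_coboundary (p + q) X (AS_cochain_cup p q X \<phi> \<psi>) xs =
        (\<Sum>i\<le>Suc (p + q). if i \<le> p then F i else G (i - p))"
    proof -
      have "?s i (AS_cochain_cup p q X \<phi> \<psi> (del_nth i xs)) = (if i \<le> p then F i else G (i - p))"
        if i: "i \<le> Suc (p + q)" for i
      proof (cases "i \<le> p")
        case True
        then have "take (Suc p) (del_nth i xs) = del_nth i (take (Suc (Suc p)) xs)"
          "drop p (del_nth i xs) = drop (Suc p) xs"
          using len by (auto simp: del_nth_def min_def drop_take Suc_diff_le)
        then show ?thesis using True del_nth_AS_simplices[OF xs i]
          by (simp add: AS_cochain_cup_def F_def)
      next
        case False
        then have "take (Suc p) (del_nth i xs) = take (Suc p) xs"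
          "drop p (del_nth i xs) = del_nth (i - p) (drop p xs)"
          using len i by (auto simp: del_nth_def min_def drop_take)
        then show ?thesis using False del_nth_AS_simplices[OF xs i]
          by (simp add: AS_cochain_cup_def G_def)
      qed
      then show ?thesis using xs
        by (subst AS_coboundary_def) (auto simp del: sum.atMost_Suc intro!: sum.cong)
    qed
    have "(\<Sum>i\<le>Suc (p + q). if i \<le> p then F i else G (i - p)) = sum F {..p} + (\<Sum>i\<in>{Suc p..Suc (p + q)}. G (i - p))"
    proof -
      have "{..Suc (p + q)} = {..p} \<union> {Suc p..Suc (p + q)}" by auto
      moreover have "(\<Sum>i\<in>{..p} \<union> {Suc p..Suc (p + q)}. if i \<le> p then F i else G (i - p)) =
          (\<Sum>i\<in>{..p}. if i \<le> p then F i else G (i - p)) +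
          (\<Sum>i\<in>{Suc p..Suc (p + q)}. if i \<le> p then F i else G (i - p))"
        by (rule sum.union_disjoint) auto
      moreover have "(\<Sum>i\<in>{..p}. if i \<le> p then F i else G (i - p)) = sum F {..p}"
        by (rule sum.cong) auto
      moreover have "(\<Sum>i\<in>{Suc p..Suc (p + q)}. if i \<le> p then F i else G (i - p)) =
          (\<Sum>i\<in>{Suc p..Suc (p + q)}. G (i - p))"
        by (rule sum.cong) auto
      ultimately show ?thesis by simp
    qed
    also have "(\<Sum>i\<in>{Suc p..Suc (p + q)}. G (i - p)) = sum G {Suc 0..Suc q}"
      by (rule sum.reindex_bij_witness[of _ "\<lambda>i. i + p" "\<lambda>i. i - p"]) auto
    also have "sum F {..p} = sum F {..Suc p} - F (Suc p)" by simp
    also have "sum G {Suc 0..Suc q} = sum G {..Suc q} - G 0"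
      by (simp add: atMost_atLeast0 sum.atLeast_Suc_atMost[of 0 "Suc q"] del: sum.cl_ivl_Suc)
    also have "F (Suc p) = - G 0"
    proof -
      have "del_nth (Suc p) (take (Suc (Suc p)) xs) = take (Suc p) xs"
        by (simp add: del_nth_def)
      moreover have "del_nth 0 (drop p xs) = drop (Suc p) xs"
        by (simp add: del_nth_def)
      ultimately show ?thesis by (simp add: F_def G_def)
    qed
    finally have sums: "(\<Sum>i\<le>Suc (p + q). if i \<le> p then F i else G (i - p)) = sum F {..Suc p} + sum G {..Suc q}"
      by simp
    have "AS_cochain_cup (Suc p) q X (AS_coboundary p X \<phi>) \<psi> xs = sum F {..Suc p}"
      using xs t by (auto simp: AS_cochain_cup_def AS_coboundary_def F_def sum_distrib_right
          simp del: sum.atMost_Suc intro!: sum.cong)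
    moreover have "?s p (AS_cochain_cup p (Suc q) X \<phi> (AS_coboundary q X \<psi>) xs) = sum G {..Suc q}"
      using xs d by (auto simp: AS_cochain_cup_def AS_coboundary_def G_def sum_distrib_left
          simp del: sum.atMost_Suc simp flip: sum_negf intro!: sum.cong)
    ultimately show ?thesis using L sums by (auto split: if_splits)
  qed
qed

lemma AS_cup_cocycles:
  assumes "\<phi> \<in> AS_cocycles p X" "\<psi> \<in> AS_cocycles q X"
  shows "AS_cochain_cup p q X \<phi> \<psi> \<in> AS_cocycles (p + q) X"
proof -
  have "AS_cochain_cup (Suc p) q X (AS_coboundary p X \<phi>) \<psi> \<in> AS_locally_zero (Suc p + q) X"
    using assms(1) by (intro AS_cochain_cup_locally_zero_left) (simp add: AS_cocycles_def)
  moreover have "AS_cochain_cup p (Suc q) X \<phi> (AS_coboundary q X \<psi>) \<in> AS_locally_zero (p + Suc q) X"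
    using assms(2) by (intro AS_cochain_cup_locally_zero_right) (simp add: AS_cocycles_def)
  ultimately show ?thesis
    by (simp add: AS_cocycles_def AS_cochain_cup_cochain AS_coboundary_cup AS_locally_zero_add
        AS_locally_zero_uminus)
qed

lemma AS_cup_coboundaries_left:
  assumes "\<beta> \<in> AS_coboundaries p X" "\<psi> \<in> AS_cocycles q X"
  shows "AS_cochain_cup p q X \<beta> \<psi> \<in> AS_coboundaries (p + q) X"
  using assms(1)
proof (cases rule: AS_coboundariesE)
  case 1
  then show ?thesis by (simp add: AS_cochain_cup_locally_zero_left AS_locally_zero_coboundaries)
next
  case (2 p' \<alpha> \<theta>)
  let ?c = "AS_cochain_cup p' (Suc q) X \<alpha> (AS_coboundary q X \<psi>)"
  have "?c \<in> AS_locally_zero (p' + Suc q) X"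
    using assms(2) by (intro AS_cochain_cup_locally_zero_right) (simp add: AS_cocycles_def)
  then have c: "?c \<in> AS_coboundaries (p + q) X"
    using 2(1) AS_locally_zero_coboundaries[of ?c "p' + Suc q" X] by simp
  let ?d = "AS_coboundary (p' + q) X (AS_cochain_cup p' q X \<alpha> \<psi>)"
  have d: "?d \<in> AS_coboundaries (p + q) X"
    using AS_coboundary_coboundaries[OF AS_cochain_cup_cochain[of p' q X \<alpha> \<psi>]] 2(1) by simp
  have "AS_cochain_cup p q X (AS_coboundary p' X \<alpha>) \<psi> = ?d + (if even p' then - ?c else ?c)"
    by (simp add: AS_coboundary_cup 2(1))
  also have "\<dots> \<in> AS_coboundaries (p + q) X"
    using c d by (simp add: AS_coboundaries_add AS_coboundaries_uminus)
  finally show ?thesis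
    using 2 AS_cochain_cup_locally_zero_left[of \<theta> p X q \<psi>]
    by (simp add: AS_cochain_cup_add_left AS_coboundaries_add AS_locally_zero_coboundaries)
qed

lemma AS_cup_coboundaries_right:
  assumes "\<phi> \<in> AS_cocycles p X" "\<beta> \<in> AS_coboundaries q X"
  shows "AS_cochain_cup p q X \<phi> \<beta> \<in> AS_coboundaries (p + q) X"
  using assms(2)
proof (cases rule: AS_coboundariesE)
  case 1
  then show ?thesis by (simp add: AS_cochain_cup_locally_zero_right AS_locally_zero_coboundaries)
next
  case (2 q' \<alpha> \<theta>)
  let ?c = "AS_cochain_cup (Suc p) q' X (AS_coboundary p X \<phi>) \<alpha>"
  have "?c \<in> AS_locally_zero (Suc p + q') X"
    using assms(1) by (intro AS_cochain_cup_locally_zero_left) (simp add: AS_cocycles_def)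
  then have c: "?c \<in> AS_coboundaries (p + q) X"
    using 2(1) AS_locally_zero_coboundaries[of ?c "Suc p + q'" X] by simp
  let ?d = "AS_coboundary (p + q') X (AS_cochain_cup p q' X \<phi> \<alpha>)"
  have d: "?d \<in> AS_coboundaries (p + q) X"
    using AS_coboundary_coboundaries[OF AS_cochain_cup_cochain[of p q' X \<phi> \<alpha>]] 2(1) by simp
  have "AS_cochain_cup p q X \<phi> (AS_coboundary q' X \<alpha>) = (if even p then ?d - ?c else - (?d - ?c))"
    by (simp add: AS_coboundary_cup 2(1))
  also have "\<dots> \<in> AS_coboundaries (p + q) X"
    using AS_coboundaries_add[OF d AS_coboundaries_uminus[OF c]] AS_coboundaries_uminus[of "?d - ?c"]
    by simp
  finally show ?thesis
    using 2 AS_cochain_cup_locally_zero_right[of \<theta> q X p \<phi>]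
    by (simp add: AS_cochain_cup_add_right AS_coboundaries_add AS_locally_zero_coboundaries)
qed

lemma AS_cup_class:
  assumes \<phi>: "\<phi> \<in> AS_cocycles p X" and \<psi>: "\<psi> \<in> AS_cocycles q X"
  shows "AS_cup p q X (AS_class p X \<phi>) (AS_class q X \<psi>) =
     AS_class (p + q) X (AS_cochain_cup p q X \<phi> \<psi>)"
proof -
  have "AS_class (p + q) X (AS_cochain_cup p q X \<phi>' \<psi>') = AS_class (p + q) X (AS_cochain_cup p q X \<phi> \<psi>)"
    if "\<phi>' \<in> AS_class p X \<phi>" "\<psi>' \<in> AS_class q X \<psi>" for \<phi>' \<psi>'
  proof (rule AS_class_eq)
    have b: "\<phi>' - \<phi> \<in> AS_coboundaries p X" and c: "\<psi>' - \<psi> \<in> AS_coboundaries q X"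
      using that by (simp_all add: mem_AS_class)
    have "\<psi> + (\<psi>' - \<psi>) \<in> AS_cocycles q X"
      using \<psi> c AS_coboundaries_cocycles by (intro AS_cocycles_add) auto
    then have \<psi>': "\<psi>' \<in> AS_cocycles q X" by simp
    have "AS_cochain_cup p q X \<phi>' \<psi>' - AS_cochain_cup p q X \<phi> \<psi> =
        AS_cochain_cup p q X (\<phi>' - \<phi>) \<psi>' + AS_cochain_cup p q X \<phi> (\<psi>' - \<psi>)"
      by (auto simp: AS_cochain_cup_def fun_eq_iff algebra_simps)
    also have "\<dots> \<in> AS_coboundaries (p + q) X"
      by (intro AS_coboundaries_add AS_cup_coboundaries_left AS_cup_coboundaries_right b c \<phi> \<psi>')
    finally show "AS_cochain_cup p q X \<phi>' \<psi>' - AS_cochain_cup p q X \<phi> \<psi> \<in> AS_coboundaries (p + q) X" .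
  qed
  then show ?thesis
    unfolding AS_cup_def using AS_class_self[of \<phi> p X] AS_class_self[of \<psi> q X] by blast
qed


section \<open>Spaces of paths\<close>

definition compact_open_topology :: "'a topology \<Rightarrow> 'b topology \<Rightarrow> ('a \<Rightarrow> 'b) topology" where
  "compact_open_topology X Y = topology_generated_by
     {{f \<in> extensional (topspace X). continuous_map X Y f \<and> f ` K \<subseteq> U} | K U.
        compactin X K \<and> openin Y U}"

lemma topspace_compact_open_topology:
  "topspace (compact_open_topology X Y) = {f \<in> extensional (topspace X). continuous_map X Y f}"
proof -
  have "\<exists>K U. compactin X K \<and> openin Y U \<and>
      {f \<in> extensional (topspace X). continuous_map X Y f} =
      {f \<in> extensional (topspace X). continuous_map X Y f \<and> f ` K \<subseteq> U}"
    by (intro exI[of _ "{}"]) auto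
  then show ?thesis
    unfolding compact_open_topology_def topology_generated_by_topspace by blast
qed

abbreviation path_space :: "'a topology \<Rightarrow> (real \<Rightarrow> 'a) topology" where
  "path_space Z \<equiv> compact_open_topology (top_of_set {0..1}) Z"


section \<open>Finitely supported probability measures\<close>

text \<open>
  A finitely supported probability measure is a probability mass function. The requirement that
  the support be finite is not redundant, since infinite sets have cardinality 0.
\<close>

definition fin_measures :: "nat \<Rightarrow> 'a set \<Rightarrow> 'a pmf set" where
  "fin_measures n Z = {\<mu>. set_pmf \<mu> \<subseteq> Z \<and> finite (set_pmf \<mu>) \<and> card (set_pmf \<mu>) \<le> n}"

definition eps_nbhd :: "real \<Rightarrow> 'a::metric_space set \<Rightarrow> 'a set" where
  "eps_nbhd e A = (\<Union>x\<in>A. ball x e)"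

definition levy_prokhorov :: "'a::metric_space pmf \<Rightarrow> 'a pmf \<Rightarrow> real" where
  "levy_prokhorov \<mu> \<nu> = Inf {e. e > 0 \<and> (\<forall>A \<in> sets borel.
     measure_pmf.prob \<mu> A \<le> measure_pmf.prob \<nu> (eps_nbhd e A) + e \<and>
     measure_pmf.prob \<nu> A \<le> measure_pmf.prob \<mu> (eps_nbhd e A) + e)}"

definition fin_measure_space :: "nat \<Rightarrow> 'a::metric_space pmf topology" where
  "fin_measure_space n = Metric_space.mtopology (fin_measures n UNIV) levy_prokhorov"


lemma eps_nbhd_borel: "eps_nbhd e A \<in> sets borel"
  unfolding eps_nbhd_def by (intro borel_open open_UN) auto

lemma levy_prokhorov_nonneg: "0 \<le> levy_prokhorov \<mu> \<nu>"
  unfolding levy_prokhorov_def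
proof (rule cInf_greatest)
  show "{e. e > 0 \<and> (\<forall>A \<in> sets borel.
     measure_pmf.prob \<mu> A \<le> measure_pmf.prob \<nu> (eps_nbhd e A) + e \<and>
     measure_pmf.prob \<nu> A \<le> measure_pmf.prob \<mu> (eps_nbhd e A) + e)} \<noteq> {}" (is "?S \<noteq> {}")
  proof -
    have "measure_pmf.prob p A \<le> measure_pmf.prob q B + 1" for p q :: "'a pmf" and A B
      using measure_pmf.prob_le_1[of p A] measure_nonneg[of "measure_pmf q" B] by linarith
    then have "1 \<in> ?S" by simp
    then show ?thesis by blast
  qed
qed simp

lemma levy_prokhorov_commute: "levy_prokhorov \<mu> \<nu> = levy_prokhorov \<nu> \<mu>"
  unfolding levy_prokhorov_def by (simp add: conj_commute)

lemma levy_prokhorov_le: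
  assumes "e > 0" "\<And>A. A \<in> sets borel \<Longrightarrow> measure_pmf.prob \<mu> A \<le> measure_pmf.prob \<nu> (eps_nbhd e A) + e"
    "\<And>A. A \<in> sets borel \<Longrightarrow> measure_pmf.prob \<nu> A \<le> measure_pmf.prob \<mu> (eps_nbhd e A) + e"
  shows "levy_prokhorov \<mu> \<nu> \<le> e"
  unfolding levy_prokhorov_def
  by (rule cInf_lower) (use assms in \<open>auto intro!: bdd_belowI[of _ 0]\<close>)

lemma levy_prokhorov_less:
  assumes "levy_prokhorov \<mu> \<nu> < e" "A \<in> sets borel"
  shows "measure_pmf.prob \<mu> A \<le> measure_pmf.prob \<nu> (eps_nbhd e A) + e"
proof -
  define S where "S = {e. e > 0 \<and> (\<forall>A \<in> sets borel.
     measure_pmf.prob \<mu> A \<le> measure_pmf.prob \<nu> (eps_nbhd e A) + e \<and>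
     measure_pmf.prob \<nu> A \<le> measure_pmf.prob \<mu> (eps_nbhd e A) + e)}"
  have "measure_pmf.prob p A \<le> measure_pmf.prob q B + 1" for p q :: "'a pmf" and A B
    using measure_pmf.prob_le_1[of p A] measure_nonneg[of "measure_pmf q" B] by linarith
  then have "1 \<in> S" by (simp add: S_def)
  then have "S \<noteq> {}" by blast
  moreover have "Inf S < e" using assms(1) by (simp add: levy_prokhorov_def S_def)
  ultimately obtain d where d: "d \<in> S" "d < e" using cInf_lessD[of S e] by blast
  have "measure_pmf.prob \<mu> A \<le> measure_pmf.prob \<nu> (eps_nbhd d A) + d"
    using d(1) assms(2) by (simp add: S_def)
  also have "measure_pmf.prob \<nu> (eps_nbhd d A) \<le> measure_pmf.prob \<nu> (eps_nbhd e A)"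
    using d(2) by (intro measure_pmf.finite_measure_mono) (auto simp: eps_nbhd_def)
  finally show ?thesis using d(2) by linarith
qed

lemma eps_nbhd_eps_nbhd: "eps_nbhd d (eps_nbhd e A) \<subseteq> eps_nbhd (e + d) A"
proof
  fix z assume "z \<in> eps_nbhd d (eps_nbhd e A)"
  then obtain x y where "x \<in> A" "dist x y < e" "dist y z < d" by (auto simp: eps_nbhd_def)
  moreover from this have "dist x z < e + d" using dist_triangle[of x z y] by linarith
  ultimately show "z \<in> eps_nbhd (e + d) A" by (auto simp: eps_nbhd_def)
qed

lemma levy_prokhorov_triangle: "levy_prokhorov \<mu> \<rho> \<le> levy_prokhorov \<mu> \<nu> + levy_prokhorov \<nu> \<rho>"
proof -
  have half: "measure_pmf.prob p A \<le> measure_pmf.prob r (eps_nbhd (a + b) A) + (a + b)"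
    if "levy_prokhorov p q < a" "levy_prokhorov q r < b" "A \<in> sets borel"
    for p q r :: "'a pmf" and a b A
  proof -
    have "measure_pmf.prob p A \<le> measure_pmf.prob q (eps_nbhd a A) + a"
      using levy_prokhorov_less that by blast
    also have "measure_pmf.prob q (eps_nbhd a A) \<le> measure_pmf.prob r (eps_nbhd b (eps_nbhd a A)) + b"
      using levy_prokhorov_less that(2) eps_nbhd_borel by blast
    also have "measure_pmf.prob r (eps_nbhd b (eps_nbhd a A)) \<le> measure_pmf.prob r (eps_nbhd (a + b) A)"
      using eps_nbhd_eps_nbhd[of b a A] by (intro measure_pmf.finite_measure_mono) auto
    finally show ?thesis by linarith
  qed
  show ?thesis
  proof (rule field_le_epsilon)
    fix t :: real assume t: "t > 0"
    let ?a = "levy_prokhorov \<mu> \<nu> + t / 2" and ?b = "levy_prokhorov \<nu> \<rho> + t / 2"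
    have ab: "levy_prokhorov \<mu> \<nu> < ?a" "levy_prokhorov \<nu> \<rho> < ?b" using t by auto
    have ba: "levy_prokhorov \<rho> \<nu> < ?b" "levy_prokhorov \<nu> \<mu> < ?a"
      using ab levy_prokhorov_commute by metis+
    have "levy_prokhorov \<mu> \<rho> \<le> ?a + ?b"
    proof (rule levy_prokhorov_le)
      show "0 < ?a + ?b" using levy_prokhorov_nonneg[of \<mu> \<nu>] levy_prokhorov_nonneg[of \<nu> \<rho>] t by linarith
      show "measure_pmf.prob \<mu> A \<le> measure_pmf.prob \<rho> (eps_nbhd (?a + ?b) A) + (?a + ?b)"
        if "A \<in> sets borel" for A using half[OF ab that] .
      show "measure_pmf.prob \<rho> A \<le> measure_pmf.prob \<mu> (eps_nbhd (?a + ?b) A) + (?a + ?b)"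
        if "A \<in> sets borel" for A using half[OF ba that] by (simp only: add.commute)
    qed
    then show "levy_prokhorov \<mu> \<rho> \<le> levy_prokhorov \<mu> \<nu> + levy_prokhorov \<nu> \<rho> + t" by simp
  qed
qed

lemma levy_prokhorov_same: "levy_prokhorov \<mu> \<mu> = 0"
proof -
  have "levy_prokhorov \<mu> \<mu> \<le> 0 + t" if t: "t > 0" for t
  proof -
    have "measure_pmf.prob \<mu> A \<le> measure_pmf.prob \<mu> (eps_nbhd t A) + t" for A
    proof -
      have "measure_pmf.prob \<mu> A \<le> measure_pmf.prob \<mu> (eps_nbhd t A)"
        using t by (intro measure_pmf.finite_measure_mono) (force simp: eps_nbhd_def)+
      then show ?thesis using t by linarith
    qed
    then show ?thesis using t by (simp add: levy_prokhorov_le)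
  qed
  then have "levy_prokhorov \<mu> \<mu> \<le> 0" by (rule field_le_epsilon)
  then show ?thesis using levy_prokhorov_nonneg[of \<mu> \<mu>] by linarith
qed

lemma levy_prokhorov_eq_0_pmf_le:
  assumes "levy_prokhorov \<mu> \<nu> = 0" "finite (set_pmf \<nu>)"
  shows "pmf \<mu> x \<le> pmf \<nu> x"
proof (rule field_le_epsilon)
  fix t :: real assume t: "t > 0"
  obtain d where d: "d > 0" "\<forall>y\<in>set_pmf \<nu>. y \<noteq> x \<longrightarrow> d \<le> dist x y"
    using finite_set_avoid[OF assms(2), of x] by blast
  let ?e = "min d t"
  have "pmf \<mu> x = measure_pmf.prob \<mu> {x}" by (simp add: measure_pmf_single)
  also have "\<dots> \<le> measure_pmf.prob \<nu> (eps_nbhd ?e {x}) + ?e"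
    using levy_prokhorov_less[of \<mu> \<nu> ?e "{x}"] assms(1) t d(1) by simp
  also have "measure_pmf.prob \<nu> (eps_nbhd ?e {x}) = measure_pmf.prob \<nu> (eps_nbhd ?e {x} \<inter> set_pmf \<nu>)"
    by (simp add: measure_Int_set_pmf)
  also have "\<dots> \<le> measure_pmf.prob \<nu> {x}"
  proof (rule measure_pmf.finite_measure_mono)
    show "eps_nbhd ?e {x} \<inter> set_pmf \<nu> \<subseteq> {x}"
    proof
      fix y assume y: "y \<in> eps_nbhd ?e {x} \<inter> set_pmf \<nu>"
      then have "dist x y < d" by (simp add: eps_nbhd_def)
      then show "y \<in> {x}" using d(2) y by force
    qed
  qed simp
  finally show "pmf \<mu> x \<le> pmf \<nu> x + t" by (simp add: measure_pmf_single)
qed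

lemma Metric_space_levy_prokhorov:
  "Metric_space (fin_measures n (UNIV :: 'a::metric_space set)) levy_prokhorov"
proof
  fix \<mu> \<nu> :: "'a pmf"
  assume fin: "\<mu> \<in> fin_measures n UNIV" "\<nu> \<in> fin_measures n UNIV"
  show "levy_prokhorov \<mu> \<nu> = 0 \<longleftrightarrow> \<mu> = \<nu>"
  proof
    assume 0: "levy_prokhorov \<mu> \<nu> = 0"
    then have "levy_prokhorov \<nu> \<mu> = 0" using levy_prokhorov_commute by metis
    then show "\<mu> = \<nu>"
      using 0 fin levy_prokhorov_eq_0_pmf_le[of \<mu> \<nu>] levy_prokhorov_eq_0_pmf_le[of \<nu> \<mu>]
      by (intro pmf_eqI antisym) (auto simp: fin_measures_def)
  qed (simp add: levy_prokhorov_same)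
qed (simp_all add: levy_prokhorov_nonneg levy_prokhorov_commute levy_prokhorov_triangle)

lemma topspace_fin_measure_space [simp]: "topspace (fin_measure_space n) = fin_measures n UNIV"
  unfolding fin_measure_space_def
  by (rule Metric_space.topspace_mtopology[OF Metric_space_levy_prokhorov])


section \<open>Resolvable paths and the intertwining category\<close>

text \<open>
  \<^term>\<open>map_pmf (\<lambda>\<alpha>. \<alpha> t) \<mu>\<close> is the convex combination of the points \<open>\<alpha> t\<close> with the weights
  that \<open>\<mu>\<close> gives to the paths \<open>\<alpha>\<close>.
\<close>

definition resolver :: "(real \<Rightarrow> 'a) pmf \<Rightarrow> real \<Rightarrow> 'a pmf" where
  "resolver \<mu> = (\<lambda>t\<in>{0..1}. map_pmf (\<lambda>\<alpha>. \<alpha> t) \<mu>)"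

definition resolvable_paths :: "nat \<Rightarrow> (real \<Rightarrow> 'a::metric_space pmf) set" where
  "resolvable_paths n = {f \<in> topspace (path_space (fin_measure_space n)).
     \<exists>\<mu> \<in> fin_measures n (topspace (path_space (euclidean :: 'a topology))). f = resolver \<mu>}"

definition based_resolvable_space ::
    "nat \<Rightarrow> 'a::metric_space \<Rightarrow> (real \<Rightarrow> 'a pmf) topology" where
  "based_resolvable_space n x0 =
     subtopology (path_space (fin_measure_space n)) {f \<in> resolvable_paths n. f 1 = return_pmf x0}"

text \<open>
  The infimum of the empty set in \<^typ>\<open>enat\<close> is \<open>\<infinity>\<close>. The basepoint is an argument because the
  definition refers to it.
\<close>

definition icat :: "'a::metric_space \<Rightarrow> enat" where
  "icat x0 = Inf {enat n | n. \<exists>H :: 'a \<Rightarrow> real \<Rightarrow> 'a pmf.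
     continuous_map euclidean (based_resolvable_space (n + 1) x0) H \<and>
     (\<forall>x. H x 0 = return_pmf x)}"

end

theory Submission
  imports Defs
begin

text \<open>
  Suppose \<open>icat x0 \<le> 1\<close>. Then there is a continuous family of paths \<open>H x\<close> of measures with at most two
  points, from the Dirac measure at \<open>x\<close> to the Dirac measure at \<open>x0\<close>, and resolvability says that
  \<open>H x\<close> is a combination of at most two paths in \<open>X\<close> with weights that do not depend on the time.
  Let \<open>C\<close> be the set of all \<open>x\<close> for which all these weights can be taken to be equal, which means that
  every \<open>H x t\<close> is either a Dirac measure or has two points of weight \<open>1/2\<close>.

  On \<open>C\<close> the support of \<open>H x t\<close> is an unordered pair of points that depends continuously on \<open>t\<close> and
  \<open>x\<close>. It deforms the diagonal map \<open>C \<rightarrow> SP\<^sup>2(X)\<close> to a constant map, so the pullback of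
  \<open>\<alpha>\<^sub>1\<^sup>*\<close> to \<open>C\<close> is zero. Off \<open>C\<close> one of the two paths has weight more than \<open>1/2\<close> at all times, and
  following this heavy branch deforms the inclusion of the complement of \<open>C\<close> into \<open>X\<close> to a constant
  map, so \<open>\<alpha>\<^sub>2\<close> vanishes there. The set \<open>C\<close> is closed (\<open>closedin_balanced\<close>), hence taut: \<open>\<alpha>\<^sub>1\<close> vanishes even
  on an open neighbourhood \<open>N\<close> of \<open>C\<close> (\<open>AS_coboundaries_closed_nbhd\<close>). The open sets \<open>N\<close> and
  \<open>- C\<close> cover \<open>X\<close>, and therefore \<open>\<alpha>\<^sub>1 \<smile> \<alpha>\<^sub>2 = 0\<close> (\<open>AS_cup_open_cover\<close>).

  The distinction is needed because neither description works everywhere. The heavy branch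
  is not defined at weights \<open>1/2\<close>, where the two paths may exchange roles when they meet, and the
  support is discontinuous where a weight tends to zero.

  The facts about Alexander-Spanier cohomology that carry the argument, homotopy invariance and
  tautness, have a common source, \<open>AS_pullback_small_steps\<close>: maps that are pointwise close relative to
  the cochains in question have cohomologous pullbacks, whether or not they are continuous. A homotopy is
  a chain of such steps, and so is the passage from the identity to a nearest-point projection.
\<close>


section \<open>Cochains as functions on lists\<close>

text \<open>
  Splitting off the first vertex of a simplex turns the coboundary and the prism operator, the
  latter usually defined as the alternating sum over the simplices \<open>f x\<^sub>0, \<dots>, f x\<^sub>i, g x\<^sub>i, \<dots>, g x\<^sub>q\<close>, into recursions over
  lists in which the cochain varies. The identities between them then follow by induction on the
  list, without any rearrangement of double sums.
\<close>

primrec face_sum :: "'b list \<Rightarrow> ('b list \<Rightarrow> 'r::ring) \<Rightarrow> 'r" where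
  "face_sum [] \<phi> = 0"
| "face_sum (x # xs) \<phi> = \<phi> xs - face_sum xs (\<lambda>ys. \<phi> (x # ys))"

primrec prism :: "('a \<Rightarrow> 'b) \<Rightarrow> ('a \<Rightarrow> 'b) \<Rightarrow> 'a list \<Rightarrow> ('b list \<Rightarrow> 'r::ring) \<Rightarrow> 'r" where
  "prism f g [] \<phi> = 0"
| "prism f g (x # xs) \<phi> = \<phi> (f x # g x # map g xs) - prism f g xs (\<lambda>ys. \<phi> (f x # ys))"

lemma face_sum_conv_sum:
  "face_sum xs \<phi> = (\<Sum>i<length xs. if even i then \<phi> (del_nth i xs) else - \<phi> (del_nth i xs))"
proof (induction xs arbitrary: \<phi>)
  case (Cons x xs)
  have "(\<Sum>i<length (x # xs). if even i then \<phi> (del_nth i (x # xs)) else - \<phi> (del_nth i (x # xs))) =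
      \<phi> xs + (\<Sum>i<length xs. if odd i then \<phi> (x # del_nth i xs) else - \<phi> (x # del_nth i xs))"
    by (simp add: sum.lessThan_Suc_shift del: sum.lessThan_Suc cong: if_cong)
  also have "(\<Sum>i<length xs. if odd i then \<phi> (x # del_nth i xs) else - \<phi> (x # del_nth i xs)) =
      - face_sum xs (\<lambda>ys. \<phi> (x # ys))"
    unfolding Cons.IH sum_negf[symmetric] by (rule sum.cong) auto
  finally show ?case by simp
qed simp

lemma AS_coboundary_conv_face_sum:
  "xs \<in> AS_simplices (Suc q) X \<Longrightarrow> AS_coboundary q X \<phi> xs = face_sum xs \<phi>"
  by (auto simp: AS_coboundary_def face_sum_conv_sum AS_simplices_def lessThan_Suc_atMost
      simp del: sum.atMost_Suc sum.lessThan_Suc)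

lemma face_sum_cong:
  assumes "\<And>ys. Suc (length ys) = length xs \<Longrightarrow> set ys \<subseteq> set xs \<Longrightarrow> \<phi> ys = \<psi> ys"
  shows "face_sum xs \<phi> = face_sum xs \<psi>"
  unfolding face_sum_conv_sum
proof (rule sum.cong)
  fix i assume "i \<in> {..<length xs}"
  then have "\<phi> (del_nth i xs) = \<psi> (del_nth i xs)"
    by (intro assms set_del_nth) auto
  then show "(if even i then \<phi> (del_nth i xs) else - \<phi> (del_nth i xs)) =
      (if even i then \<psi> (del_nth i xs) else - \<psi> (del_nth i xs))" by simp
qed simp

lemma face_sum_map: "face_sum (map f xs) \<phi> = face_sum xs (\<lambda>ys. \<phi> (map f ys))"
  by (induction xs arbitrary: \<phi>) auto

lemma face_sum_diff: "face_sum xs (\<lambda>ys. \<phi> ys - \<psi> ys) = face_sum xs \<phi> - face_sum xs \<psi>"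
  by (induction xs arbitrary: \<phi> \<psi>) (auto simp: algebra_simps)

lemma face_sum_zero: "face_sum xs (\<lambda>_. 0) = 0"
  by (induction xs) auto

lemma face_sum_add: "face_sum xs (\<lambda>ys. \<phi> ys + \<psi> ys) = face_sum xs \<phi> + face_sum xs \<psi>"
  by (induction xs arbitrary: \<phi> \<psi>) (auto simp: algebra_simps)

lemma face_sum_sum: "finite A \<Longrightarrow> face_sum xs (\<lambda>ys. \<Sum>j\<in>A. \<phi> j ys) = (\<Sum>j\<in>A. face_sum xs (\<phi> j))"
  by (induction A rule: finite_induct) (auto simp: face_sum_zero face_sum_add)

lemma face_sum_const: "face_sum xs (\<lambda>_. a) = (if odd (length xs) then a else 0)"
  by (induction xs) auto

lemma prism_diff: "prism f g xs (\<lambda>ys. \<phi> ys - \<psi> ys) = prism f g xs \<phi> - prism f g xs \<psi>"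
  by (induction xs arbitrary: \<phi> \<psi>) (auto simp: algebra_simps)

lemma prism_cong:
  fixes \<phi> :: "'c list \<Rightarrow> 'd::ring"
  assumes "\<And>x. x \<in> set xs \<Longrightarrow> f x = f' x" "\<And>x. x \<in> set xs \<Longrightarrow> g x = g' x"
  shows "prism f g xs \<phi> = prism f' g' xs \<phi>"
  using assms
proof (induction xs arbitrary: \<phi>)
  case (Cons x xs)
  have "prism f g xs \<psi> = prism f' g' xs \<psi>" for \<psi> :: "'c list \<Rightarrow> 'd"
    by (rule Cons.IH) (use Cons.prems in auto)
  then show ?case using Cons.prems by (simp cong: map_cong)
qed simp

lemma prism_eq_0:
  assumes "\<And>ys. length ys = Suc (length xs) \<Longrightarrow> set ys \<subseteq> f ` set xs \<union> g ` set xs \<Longrightarrow> \<phi> ys = 0"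
  shows "prism f g xs \<phi> = 0"
  using assms
proof (induction xs arbitrary: \<phi>)
  case (Cons x xs)
  have "prism f g xs (\<lambda>ys. \<phi> (f x # ys)) = 0"
  proof (rule Cons.IH)
    fix ys assume "length ys = Suc (length xs)" "set ys \<subseteq> f ` set xs \<union> g ` set xs"
    then show "\<phi> (f x # ys) = 0" by (intro Cons.prems) auto
  qed
  moreover have "\<phi> (f x # g x # map g xs) = 0"
    by (rule Cons.prems) auto
  ultimately show ?case by simp
qed simp

text \<open>
  The classical chain homotopy identity. In the induction step the hypothesis is applied to the
  cochain with \<open>f x\<close> inserted in front; the two remaining terms, which contain both \<open>f x\<close> and \<open>g x\<close>,
  cancel.
\<close>

lemma face_sum_prism:
  "face_sum xs (\<lambda>ys. prism f g ys \<phi>) + prism f g xs (\<lambda>ys. face_sum ys \<phi>) =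
     \<phi> (map g xs) - \<phi> (map f xs)"
proof (induction xs arbitrary: \<phi>)
  case (Cons x xs)
  show ?case
    using Cons.IH[of "\<lambda>ys. \<phi> (f x # ys)"]
    by (simp add: face_sum_diff prism_diff face_sum_map algebra_simps)
qed simp


section \<open>Chains of small steps and homotopy invariance\<close>

lemma AS_cocycles_locally_closed:
  assumes "\<phi> \<in> AS_cocycles q X" "x \<in> topspace X"
  obtains U where "openin X U" "x \<in> U"
    "\<And>ys. length ys = Suc (Suc q) \<Longrightarrow> set ys \<subseteq> U \<Longrightarrow> face_sum ys \<phi> = 0"
proof -
  have "AS_coboundary q X \<phi> \<in> AS_locally_zero (Suc q) X"
    using assms(1) by (simp add: AS_cocycles_def)
  then obtain U where U: "openin X U" "x \<in> U"
      "\<And>ys. set ys \<subseteq> U \<Longrightarrow> AS_coboundary q X \<phi> ys = 0"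
    using AS_locally_zeroD assms(2) by metis
  have "face_sum ys \<phi> = 0" if "length ys = Suc (Suc q)" "set ys \<subseteq> U" for ys
  proof -
    have "ys \<in> AS_simplices (Suc q) X"
      using that openin_subset[OF U(1)] by (auto simp: AS_simplices_def)
    then show ?thesis using U(3)[OF that(2)] AS_coboundary_conv_face_sum by metis
  qed
  then show thesis using that U by blast
qed

text \<open>
  Maps that are close enough for a prism between them to consist of small simplices pull a cocycle
  back to cohomologous cochains. The maps may be discontinuous, which makes the lemma usable both
  for homotopies cut into small steps and for a discontinuous projection to a closed subset. The
  number of steps may be unbounded on \<open>X\<close>, and then the prisms have to be summed over all \<open>j\<close>. The
  prism from a map to itself does not vanish, so that sum need not be finite; subtracting from each
  prism the prism of \<open>g j\<close> to itself, which by itself is a chain homotopy from \<open>g j\<close> to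
  \<open>g j\<close>, removes from a simplex all terms with \<open>g (Suc j) = g j\<close> at its vertices and leaves a
  finite sum.
\<close>

lemma AS_pullback_small_steps:
  fixes g :: "nat \<Rightarrow> 'a \<Rightarrow> 'b" and \<phi> :: "'b list \<Rightarrow> 'r::ring"
  assumes stable: "\<And>x j. x \<in> topspace X \<Longrightarrow> J x \<le> j \<Longrightarrow> g j x = g' x"
    and small: "\<And>x. x \<in> topspace X \<Longrightarrow> \<exists>U. openin X U \<and> x \<in> U \<and>
       (\<forall>j ys. length ys = Suc (Suc (Suc p)) \<longrightarrow> set ys \<subseteq> g j ` U \<union> g (Suc j) ` U \<longrightarrow> face_sum ys \<phi> = 0)"
  shows "AS_pullback (Suc p) X (g 0) \<phi> - AS_pullback (Suc p) X g' \<phi> \<in> AS_coboundaries (Suc p) X"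
proof -
  define T where "T j xs = prism (g j) (g (Suc j)) xs \<phi> - prism (g j) (g j) xs \<phi>" for j xs
  define N where "N xs = Max (insert 0 (J ` set xs))" for xs
  define \<psi> where "\<psi> xs = (if xs \<in> AS_simplices p X then \<Sum>j<N xs. T j xs else 0)" for xs
  have \<psi>: "\<psi> \<in> AS_cochains p X" by (rule AS_cochainsI) (simp add: \<psi>_def)
  have J: "J x \<le> N xs" if "x \<in> set xs" for x xs
    using that by (simp add: N_def)
  have N_mono: "N ys \<le> N xs" if "set ys \<subseteq> set xs" for xs ys
    using that unfolding N_def by (intro Max_mono) auto
  have T0: "T j xs = 0" if "set xs \<subseteq> topspace X" "N xs \<le> j" for j xs
  proof -
    have "g (Suc j) x = g j x" if "x \<in> set xs" for x
      using stable[of x j] stable[of x "Suc j"] J[OF that] \<open>N xs \<le> j\<close> \<open>set xs \<subseteq> topspace X\<close> that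
      by auto
    then show ?thesis unfolding T_def using prism_cong[of xs "g j" "g j" "g (Suc j)" "g j" \<phi>] by simp
  qed
  define \<theta> where
    "\<theta> = AS_pullback (Suc p) X (g 0) \<phi> - AS_pullback (Suc p) X g' \<phi> + AS_coboundary p X \<psi>"
  have "\<theta> \<in> AS_locally_zero (Suc p) X"
  proof (rule AS_locally_zeroI)
    show "\<theta> \<in> AS_cochains (Suc p) X"
      by (simp add: \<theta>_def AS_cochains_def AS_pullback_def AS_coboundary_def)
  next
    fix x assume "x \<in> topspace X"
    then obtain U where U: "openin X U" "x \<in> U"
      and closed: "\<And>j ys. length ys = Suc (Suc (Suc p)) \<Longrightarrow> set ys \<subseteq> g j ` U \<union> g (Suc j) ` U
         \<Longrightarrow> face_sum ys \<phi> = 0"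
      using small by meson
    have "\<theta> xs = 0" if xs: "xs \<in> AS_simplices (Suc p) X" "set xs \<subseteq> U" for xs
    proof -
      have X: "set xs \<subseteq> topspace X" and len: "length xs = Suc (Suc p)"
        using xs by (auto simp: AS_simplices_def)
      have step: "face_sum xs (T j) = \<phi> (map (g (Suc j)) xs) - \<phi> (map (g j) xs)" for j
      proof -
        have prism_0: "prism (g j) (g i) xs (\<lambda>ys. face_sum ys \<phi>) = 0" if i: "i = j \<or> i = Suc j" for i
        proof (rule prism_eq_0)
          fix ys assume ys: "length ys = Suc (length xs)" "set ys \<subseteq> g j ` set xs \<union> g i ` set xs"
          have "set ys \<subseteq> g j ` U \<union> g (Suc j) ` U" using ys(2) i xs(2) by blast
          with ys(1) len show "face_sum ys \<phi> = 0" by (intro closed[of ys j]) simp_all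
        qed
        have 1: "prism (g j) (g (Suc j)) xs (\<lambda>ys. face_sum ys \<phi>) = 0"
          and 2: "prism (g j) (g j) xs (\<lambda>ys. face_sum ys \<phi>) = 0"
          by (rule prism_0, simp)+
        show ?thesis
          using face_sum_prism[of xs "g j" "g (Suc j)" \<phi>] face_sum_prism[of xs "g j" "g j" \<phi>] 1 2
          by (simp add: T_def[abs_def] face_sum_diff)
      qed
      have "AS_coboundary p X \<psi> xs = face_sum xs \<psi>"
        by (rule AS_coboundary_conv_face_sum[OF xs(1)])
      also have "\<dots> = face_sum xs (\<lambda>ys. \<Sum>j<N xs. T j ys)"
      proof (rule face_sum_cong)
        fix ys assume ys: "Suc (length ys) = length xs" "set ys \<subseteq> set xs"
        then have "ys \<in> AS_simplices p X" using X len by (auto simp: AS_simplices_def)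
        then have "\<psi> ys = (\<Sum>j<N ys. T j ys)" by (simp add: \<psi>_def)
        also have "\<dots> = (\<Sum>j<N xs. T j ys)"
          by (rule sum.mono_neutral_left) (use N_mono[OF ys(2)] T0 X ys(2) in auto)
        finally show "\<psi> ys = (\<Sum>j<N xs. T j ys)" .
      qed
      also have "\<dots> = (\<Sum>j<N xs. \<phi> (map (g (Suc j)) xs) - \<phi> (map (g j) xs))"
        by (subst face_sum_sum) (simp_all add: step)
      also have "\<dots> = \<phi> (map (g (N xs)) xs) - \<phi> (map (g 0) xs)"
        by (rule sum_lessThan_telescope)
      also have "map (g (N xs)) xs = map g' xs"
        using stable J X by auto
      finally show ?thesis using xs(1) by (simp add: \<theta>_def AS_pullback_def)
    qed
    then show "\<exists>U. openin X U \<and> x \<in> U \<and>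
        (\<forall>xs\<in>AS_simplices (Suc p) X. set xs \<subseteq> U \<longrightarrow> \<theta> xs = 0)"
      using U by blast
  qed
  then have "- AS_coboundary p X \<psi> + \<theta> \<in> AS_coboundaries (Suc p) X"
    using \<psi> by (intro AS_coboundaries_add AS_coboundaries_uminus AS_coboundary_coboundaries
        AS_locally_zero_coboundaries)
  then show ?thesis by (simp add: \<theta>_def)
qed

text \<open>
  A constant map factors through a point, whose cohomology vanishes in positive degrees; the two
  cases are the alternating zero and identity maps of the cochain complex of a point.
\<close>

lemma AS_pullback_const_coboundaries:
  fixes \<phi> :: "'b list \<Rightarrow> 'r::ring"
  assumes "\<phi> \<in> AS_cocycles (Suc p) Y" "c \<in> topspace Y"
  shows "AS_pullback (Suc p) X (\<lambda>_. c) \<phi> \<in> AS_coboundaries (Suc p) X"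
proof -
  define a where "a = \<phi> (replicate (Suc (Suc p)) c)"
  have const: "AS_pullback (Suc p) X (\<lambda>_. c) \<phi> = (\<lambda>xs. if xs \<in> AS_simplices (Suc p) X then a else 0)"
    by (auto simp: AS_pullback_def a_def AS_simplices_def map_replicate_const)
  show ?thesis
  proof (cases "even p")
    case True
    \<comment> \<open>A degenerate simplex with an odd number of vertices has boundary a single simplex.\<close>
    let ?zs = "replicate (Suc (Suc (Suc p))) c"
    have "face_sum ?zs \<phi> = 0"
      by (rule AS_cocycles_locally_closed[OF assms]) (auto simp del: replicate_Suc)
    moreover have "face_sum ?zs \<phi> = face_sum ?zs (\<lambda>_. a)"
    proof (rule face_sum_cong)
      fix ys assume "Suc (length ys) = length ?zs" "set ys \<subseteq> set ?zs"
      then have "ys = replicate (Suc (Suc p)) c"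
        by (intro replicate_eqI) auto
      then show "\<phi> ys = a" by (simp only: a_def)
    qed
    ultimately have "a = 0" using True by (simp add: face_sum_const del: face_sum.simps replicate_Suc)
    then have "AS_pullback (Suc p) X (\<lambda>_. c) \<phi> = 0" by (auto simp: const)
    then show ?thesis by (simp only: AS_locally_zero_coboundaries AS_locally_zero_zero)
  next
    case False
    \<comment> \<open>Here the constant cochain one degree lower has a constant coboundary of the same value.\<close>
    define \<psi> where "\<psi> xs = (if xs \<in> AS_simplices p X then a else 0)" for xs
    have "AS_coboundary p X \<psi> xs = a" if xs: "xs \<in> AS_simplices (Suc p) X" for xs
    proof -
      have "AS_coboundary p X \<psi> xs = face_sum xs (\<lambda>_. a)"
        unfolding AS_coboundary_conv_face_sum[OF xs]
        by (rule face_sum_cong) (use xs in \<open>auto simp: \<psi>_def AS_simplices_def\<close>)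
      then show ?thesis using xs False by (simp add: face_sum_const AS_simplices_def)
    qed
    then have "AS_pullback (Suc p) X (\<lambda>_. c) \<phi> = AS_coboundary p X \<psi>"
      using AS_cochains_eq_0[OF AS_coboundary_cochain[of p X \<psi>]] by (auto simp: const)
    moreover have "\<psi> \<in> AS_cochains p X" by (simp add: \<psi>_def AS_cochains_def)
    ultimately show ?thesis by (simp only: AS_coboundary_coboundaries)
  qed
qed

text \<open>
  The supremum of the admissible radii is 1-Lipschitz in the point, because a radius that is
  admissible at \<open>y\<close> is admissible at \<open>x\<close> after subtracting the distance from \<open>x\<close> to \<open>y\<close>. The supremum
  itself need not be admissible, but half of it is.
\<close>

lemma lipschitz_radius:
  fixes S :: "'a::metric_space set" and P :: "'a \<Rightarrow> real \<Rightarrow> bool"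
  assumes ex: "\<And>x. x \<in> S \<Longrightarrow> \<exists>r. 0 < r \<and> r \<le> 1 \<and> P x r"
    and shrink: "\<And>x y r e. x \<in> S \<Longrightarrow> y \<in> S \<Longrightarrow> P y e \<Longrightarrow> 0 < r \<Longrightarrow> dist x y + r \<le> e \<Longrightarrow> P x r"
  obtains s where "\<And>x. x \<in> S \<Longrightarrow> 0 < s x" "\<And>x. x \<in> S \<Longrightarrow> s x \<le> 1" "\<And>x. x \<in> S \<Longrightarrow> P x (s x / 2)"
    "\<And>x y. x \<in> S \<Longrightarrow> y \<in> S \<Longrightarrow> \<bar>s x - s y\<bar> \<le> dist x y"
proof -
  define A where "A x = {r. 0 < r \<and> r \<le> 1 \<and> P x r}" for x
  define s where "s x = Sup (A x)" for x
  have bdd: "bdd_above (A x)" for x by (auto simp: A_def intro: bdd_aboveI[of _ 1])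
  have ne: "A x \<noteq> {}" if "x \<in> S" for x using ex[OF that] by (auto simp: A_def)
  have upper: "r \<le> s x" if "r \<in> A x" for r x
    unfolding s_def by (rule cSup_upper[OF that bdd])
  have pos: "0 < s x" if "x \<in> S" for x
    using ne[OF that] upper[of _ x] by (force simp: A_def)
  have le1: "s x \<le> 1" if "x \<in> S" for x
    unfolding s_def by (rule cSup_least[OF ne[OF that]]) (simp add: A_def)
  have half: "P x (s x / 2)" if x: "x \<in> S" for x
  proof -
    have "s x / 2 < Sup (A x)" using pos[OF x] by (simp add: s_def)
    then obtain r where "r \<in> A x" "s x / 2 < r" using less_cSupD[OF ne[OF x]] by blast
    then show ?thesis using shrink[OF x x, of r "s x / 2"] pos[OF x] by (simp add: A_def)
  qed
  have lip: "s x \<le> s y + dist x y" if x: "x \<in> S" and y: "y \<in> S" for x y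
    unfolding s_def[of x]
  proof (rule cSup_least[OF ne[OF x]])
    fix r assume r: "r \<in> A x"
    show "r \<le> s y + dist x y"
    proof (cases "dist x y < r")
      case True
      have "r - dist x y \<in> A y"
        using r True shrink[OF y x, of r "r - dist x y"] zero_le_dist[of x y]
        by (auto simp: A_def dist_commute simp del: zero_le_dist)
      from upper[OF this] show ?thesis by simp
    qed (use pos[OF y] in linarith)
  qed
  have "\<bar>s x - s y\<bar> \<le> dist x y" if "x \<in> S" "y \<in> S" for x y
    using lip[OF that] lip[OF that(2,1)] by (simp add: dist_commute abs_le_iff)
  then show thesis using that pos le1 half by blast
qed

lemma abs_diff_clamped_multiples:
  fixes a b :: real
  assumes "0 < a" "0 < b"
  shows "\<bar>min 1 (real j * a) - min 1 (real j * b)\<bar> \<le> \<bar>a - b\<bar> / min a b"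
proof -
  have *: "\<bar>min 1 (real j * a) - min 1 (real j * b)\<bar> \<le> \<bar>a - b\<bar> / min a b"
    if "a \<le> b" "0 < a" for a b :: real
  proof (cases "1 \<le> real j * a")
    case True
    moreover have "real j * a \<le> real j * b" using that by (intro mult_left_mono) auto
    ultimately show ?thesis using that by simp
  next
    case False
    have "real j * a \<le> real j * b" using that by (intro mult_left_mono) auto
    then have "\<bar>min 1 (real j * a) - min 1 (real j * b)\<bar> \<le> real j * (b - a)"
      using False by (simp add: right_diff_distrib)
    also have "\<dots> \<le> (1 / a) * (b - a)"
      using False that by (intro mult_right_mono) (simp_all add: field_simps)
    finally show ?thesis using that by simp
  qed
  show ?thesis
    using *[of a b] *[of b a] assms by (cases "a \<le> b") (auto simp: abs_minus_commute min.commute)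
qed

text \<open>
  The homotopy is cut into steps of length \<open>s x / 4\<close> over the point \<open>x\<close>, where \<open>s\<close> is a Lipschitz
  function that measures how small a box around \<open>(t, x)\<close> must be, for all \<open>t\<close> at once, to be sent
  into a set on whose simplices the coboundary of \<open>\<phi>\<close> vanishes.
\<close>

proposition AS_pullback_homotopic:
  fixes S :: "'a::metric_space set" and \<phi> :: "'b list \<Rightarrow> 'r::ring"
  assumes h: "continuous_map (prod_topology (top_of_set {0..1::real}) (top_of_set S)) Y h"
    and \<phi>: "\<phi> \<in> AS_cocycles (Suc p) Y"
  shows "AS_pullback (Suc p) (top_of_set S) (\<lambda>x. h (0, x)) \<phi> -
     AS_pullback (Suc p) (top_of_set S) (\<lambda>x. h (1, x)) \<phi> \<in> AS_coboundaries (Suc p) (top_of_set S)"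
proof -
  define P where "P x r \<longleftrightarrow> (\<forall>t\<in>{0..1}. \<forall>ys. length ys = Suc (Suc (Suc p)) \<longrightarrow>
      set ys \<subseteq> h ` (({0..1} \<inter> ball t r) \<times> (S \<inter> ball x r)) \<longrightarrow> face_sum ys \<phi> = 0)" for x r
  have ex: "\<exists>r. 0 < r \<and> r \<le> 1 \<and> P x r" if x: "x \<in> S" for x
  proof -
    define \<G> where "\<G> = {G. open G \<and> (\<forall>ys. length ys = Suc (Suc (Suc p)) \<longrightarrow>
        set ys \<subseteq> h ` (({0..1} \<times> S) \<inter> G) \<longrightarrow> face_sum ys \<phi> = 0)}"
    have cover: "{0..1} \<times> {x} \<subseteq> \<Union>\<G>"
    proof
      fix z assume z: "z \<in> {0..1::real} \<times> {x}"
      then have zS: "z \<in> {0..1} \<times> S" using x by auto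
      then have "h z \<in> topspace Y" using continuous_map_image_subset_topspace[OF h] by force
      then obtain V where V: "openin Y V" "h z \<in> V"
          "\<And>ys. length ys = Suc (Suc (Suc p)) \<Longrightarrow> set ys \<subseteq> V \<Longrightarrow> face_sum ys \<phi> = 0"
        using AS_cocycles_locally_closed[OF \<phi>] by metis
      have "openin (top_of_set ({0..1} \<times> S)) {w \<in> {0..1} \<times> S. h w \<in> V}"
        using openin_continuous_map_preimage[OF h V(1)] by (auto simp: Collect_conj_eq)
      then obtain G where G: "open G" "{w \<in> {0..1} \<times> S. h w \<in> V} = ({0..1} \<times> S) \<inter> G"
        by (auto simp: openin_open)
      have "G \<in> \<G>" unfolding \<G>_def using G V(3) by blast
      moreover have "z \<in> G" using G(2) zS V(2) by blast
      ultimately show "z \<in> \<Union>\<G>" by blast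
    qed
    have "compact ({0..1::real} \<times> {x})" by (intro compact_Times) auto
    then obtain e where e: "0 < e" "\<And>z. z \<in> {0..1} \<times> {x} \<Longrightarrow> \<exists>G\<in>\<G>. ball z e \<subseteq> G"
      using Heine_Borel_lemma[OF _ cover] by (metis (mono_tags, lifting) \<G>_def mem_Collect_eq)
    define r where "r = min 1 (e / 2)"
    have "P x r"
      unfolding P_def
    proof (intro ballI allI impI)
      fix t :: real and ys
      assume t: "t \<in> {0..1}" and len: "length ys = Suc (Suc (Suc p))"
        and ys: "set ys \<subseteq> h ` (({0..1} \<inter> ball t r) \<times> (S \<inter> ball x r))"
      obtain G where G: "G \<in> \<G>" "ball (t, x) e \<subseteq> G" using e(2)[of "(t, x)"] t by auto
      have "ball t r \<times> ball x r \<subseteq> ball (t, x) e"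
      proof clarsimp
        fix u y assume *: "dist t u < r" "dist x y < r"
        have "dist (t, x) (u, y) \<le> dist t u + dist x y"
          by (simp add: dist_Pair_Pair sqrt_sum_squares_le_sum)
        then show "dist (t, x) (u, y) < e" using * by (simp add: r_def)
      qed
      then have "set ys \<subseteq> h ` (({0..1} \<times> S) \<inter> G)" using ys G(2) by blast
      then show "face_sum ys \<phi> = 0" using G(1) len by (simp add: \<G>_def)
    qed
    then show ?thesis using e(1) by (intro exI[of _ r]) (simp add: r_def)
  qed
  have shrink: "P x r" if "P y e" "0 < r" "dist x y + r \<le> e" for x y r e
  proof -
    have "ball x r \<subseteq> ball y e"
    proof
      fix z assume "z \<in> ball x r"
      then show "z \<in> ball y e"
        using that(3) dist_triangle[of y z x] by (simp add: dist_commute)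
    qed
    moreover have "ball t r \<subseteq> ball t e" for t :: real
      using that(3) zero_le_dist[of x y] by (intro subset_ball) linarith
    ultimately show ?thesis using that(1) unfolding P_def by (meson Int_mono Sigma_mono image_mono order_trans subset_refl)
  qed
  obtain s where s: "\<And>x. x \<in> S \<Longrightarrow> 0 < s x" "\<And>x. x \<in> S \<Longrightarrow> s x \<le> 1"
      "\<And>x. x \<in> S \<Longrightarrow> P x (s x / 2)"
    and lip: "\<And>x y. x \<in> S \<Longrightarrow> y \<in> S \<Longrightarrow> \<bar>s x - s y\<bar> \<le> dist x y"
    by (rule lipschitz_radius[of S P]) (use ex shrink in blast)+
  define \<tau> where "\<tau> j x = min 1 (real j * (s x / 4))" for j x
  define g where "g j x = h (\<tau> j x, x)" for j x
  have \<tau>01: "\<tau> j x \<in> {0..1}" if "x \<in> S" for j x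
    using s(1)[OF that] by (simp add: \<tau>_def)
  have "AS_pullback (Suc p) (top_of_set S) (g 0) \<phi> -
      AS_pullback (Suc p) (top_of_set S) (\<lambda>x. h (1, x)) \<phi> \<in> AS_coboundaries (Suc p) (top_of_set S)"
  proof (rule AS_pullback_small_steps[where J = "\<lambda>x. nat \<lceil>4 / s x\<rceil>"])
    fix x j assume x: "x \<in> topspace (top_of_set S)" and j: "nat \<lceil>4 / s x\<rceil> \<le> j"
    have "4 / s x \<le> real j" using j by linarith
    then have "1 \<le> real j * (s x / 4)" using s(1)[of x] x by (simp add: field_simps)
    then show "g j x = h (1, x)" by (simp add: g_def \<tau>_def)
  next
    fix x assume "x \<in> topspace (top_of_set S)"
    then have x: "x \<in> S" by simp
    \<comment> \<open>This radius makes \<open>\<tau> j\<close> oscillate by at most \<open>s x / 8\<close> near \<open>x\<close>, for all \<open>j\<close>.\<close>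
    define \<delta> where "\<delta> = (s x)\<^sup>2 / 16"
    have "(s x)\<^sup>2 \<le> s x * 1"
      using s(1,2)[OF x] unfolding power2_eq_square by (intro mult_left_mono) auto
    then have \<delta>: "0 < \<delta>" "\<delta> \<le> s x / 16" using s(1)[OF x] by (auto simp: \<delta>_def)
    have near: "\<bar>\<tau> j x - \<tau> j y\<bar> \<le> s x / 8" "\<bar>\<tau> j x - \<tau> (Suc j) y\<bar> < s x / 2" "dist x y < s x / 2"
      if y: "y \<in> S \<inter> ball x \<delta>" for y j
    proof -
      have d: "\<bar>s x - s y\<bar> \<le> \<delta>" using lip[of x y] x y by auto
      then have sy: "s x / 2 \<le> s y" "s y \<le> s x * 17 / 16" using \<delta> by (simp_all add: abs_le_iff)
      have "\<bar>\<tau> j x - \<tau> j y\<bar> \<le> \<bar>s x / 4 - s y / 4\<bar> / min (s x / 4) (s y / 4)"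
        unfolding \<tau>_def using s(1) x y by (intro abs_diff_clamped_multiples) auto
      also have "\<dots> \<le> (\<delta> / 4) / (s x / 8)"
        using d sy s(1)[OF x] \<delta> by (intro frac_le) (auto simp: min_def abs_le_iff field_simps)
      also have "\<dots> = s x / 8" using s(1)[OF x] by (simp add: \<delta>_def power2_eq_square field_simps)
      finally show 1: "\<bar>\<tau> j x - \<tau> j y\<bar> \<le> s x / 8" .
      have "\<bar>\<tau> j y - \<tau> (Suc j) y\<bar> \<le> s y / 4"
      proof -
        have "\<tau> (Suc j) y = min 1 (real j * (s y / 4) + s y / 4)"
          by (simp add: \<tau>_def distrib_right add.commute add_divide_distrib)
        then show ?thesis using s(1)[of y] y unfolding \<tau>_def by (simp add: min_def abs_if)
      qed
      then show "\<bar>\<tau> j x - \<tau> (Suc j) y\<bar> < s x / 2" using 1 sy s(1)[OF x] by linarith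
      show "dist x y < s x / 2" using y \<delta> s(1)[OF x] by auto
    qed
    let ?U = "S \<inter> ball x \<delta>"
    have "face_sum ys \<phi> = 0" if "length ys = Suc (Suc (Suc p))" "set ys \<subseteq> g j ` ?U \<union> g (Suc j) ` ?U" for j ys
    proof -
      have "g i ` ?U \<subseteq> h ` (({0..1} \<inter> ball (\<tau> j x) (s x / 2)) \<times> (S \<inter> ball x (s x / 2)))"
        if "i = j \<or> i = Suc j" for i
      proof clarify
        fix y assume y: "y \<in> S" "y \<in> ball x \<delta>"
        have "\<tau> i y \<in> {0..1} \<inter> ball (\<tau> j x) (s x / 2)" "y \<in> S \<inter> ball x (s x / 2)"
          using that near(1,2)[of y j] near(3)[of y] y \<tau>01[of y] s(1)[OF x] by (auto simp: dist_real_def)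
        then show "g i y \<in> h ` (({0..1} \<inter> ball (\<tau> j x) (s x / 2)) \<times> (S \<inter> ball x (s x / 2)))"
          unfolding g_def by blast
      qed
      then have "set ys \<subseteq> h ` (({0..1} \<inter> ball (\<tau> j x) (s x / 2)) \<times> (S \<inter> ball x (s x / 2)))"
        using that(2) by blast
      then show ?thesis using s(3)[OF x] that(1) \<tau>01[OF x] unfolding P_def by blast
    qed
    then show "\<exists>U. openin (top_of_set S) U \<and> x \<in> U \<and>
        (\<forall>j ys. length ys = Suc (Suc (Suc p)) \<longrightarrow> set ys \<subseteq> g j ` U \<union> g (Suc j) ` U \<longrightarrow> face_sum ys \<phi> = 0)"
      using x \<delta>(1) by (intro exI[of _ ?U]) (auto simp: openin_open)
  qed
  moreover have "g 0 = (\<lambda>x. h (0, x))" by (simp add: g_def \<tau>_def fun_eq_iff)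
  ultimately show ?thesis by simp
qed

corollary AS_pullback_nullhomotopic:
  fixes S :: "'a::metric_space set"
  assumes h: "continuous_map (prod_topology (top_of_set {0..1::real}) (top_of_set S)) Y h"
    and \<phi>: "\<phi> \<in> AS_cocycles (Suc p) Y"
    and h0: "\<And>x. x \<in> S \<Longrightarrow> h (0, x) = f x" and h1: "\<And>x. x \<in> S \<Longrightarrow> h (1, x) = c"
    and c: "c \<in> topspace Y"
  shows "AS_pullback (Suc p) (top_of_set S) f \<phi> \<in> AS_coboundaries (Suc p) (top_of_set S)"
proof -
  have eq: "AS_pullback q (top_of_set S) f1 \<phi> = AS_pullback q (top_of_set S) f2 \<phi>"
    if "\<And>x. x \<in> S \<Longrightarrow> f1 x = f2 x" for q f1 f2
  proof
    fix xs
    have "map f1 xs = map f2 xs" if "set xs \<subseteq> S"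
      unfolding map_eq_conv using that \<open>\<And>x. x \<in> S \<Longrightarrow> f1 x = f2 x\<close> by blast
    then have "\<phi> (map f1 xs) = \<phi> (map f2 xs)" if "set xs \<subseteq> S" using that by metis
    then show "AS_pullback q (top_of_set S) f1 \<phi> xs = AS_pullback q (top_of_set S) f2 \<phi> xs"
      by (auto simp: AS_pullback_def AS_simplices_def)
  qed
  have "AS_pullback (Suc p) (top_of_set S) (\<lambda>x. h (0, x)) \<phi> = AS_pullback (Suc p) (top_of_set S) f \<phi>"
    by (rule eq) (rule h0)
  moreover have "AS_pullback (Suc p) (top_of_set S) (\<lambda>x. h (1, x)) \<phi> =
      AS_pullback (Suc p) (top_of_set S) (\<lambda>_. c) \<phi>"
    by (rule eq) (rule h1)
  ultimately have "AS_pullback (Suc p) (top_of_set S) f \<phi> -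
      AS_pullback (Suc p) (top_of_set S) (\<lambda>_. c) \<phi> \<in> AS_coboundaries (Suc p) (top_of_set S)"
    using AS_pullback_homotopic[OF h \<phi>] by (simp only:)
  from AS_coboundaries_add[OF this AS_pullback_const_coboundaries[OF \<phi> c]]
  show ?thesis unfolding diff_add_cancel .
qed


section \<open>Tautness of closed subsets\<close>

text \<open>
  The Alexander-Spanier complex does not see continuity. A map \<open>r\<close> that sends each point to a nearly
  nearest point of \<open>C\<close> moves the points near \<open>C\<close> so little that it pulls \<open>\<phi>\<close> back to a cohomologous
  cochain, and it pulls cochains that are locally zero on \<open>C\<close> back to cochains that are locally zero
  near \<open>C\<close>. So \<open>r\<close> transports a relation that makes \<open>\<phi>\<close> a coboundary on \<open>C\<close> to a neighbourhood.
\<close>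

proposition AS_coboundaries_closed_nbhd:
  fixes C :: "'a::metric_space set" and \<phi> :: "'a list \<Rightarrow> 'r::ring"
  assumes C: "closed C" and \<phi>: "\<phi> \<in> AS_cocycles (Suc p) euclidean"
    and restr: "AS_pullback (Suc p) (top_of_set C) id \<phi> \<in> AS_coboundaries (Suc p) (top_of_set C)"
  obtains N where "open N" "C \<subseteq> N"
    "AS_pullback (Suc p) (top_of_set N) id \<phi> \<in> AS_coboundaries (Suc p) (top_of_set N)"
proof -
  obtain \<psi> \<theta> where \<theta>: "\<theta> \<in> AS_locally_zero (Suc p) (top_of_set C)"
    and eq: "AS_pullback (Suc p) (top_of_set C) id \<phi> = AS_coboundary p (top_of_set C) \<psi> + \<theta>"
    using restr by (auto simp: AS_coboundaries_def)
  have \<phi>_C: "\<phi> xs = face_sum xs \<psi> + \<theta> xs" if "length xs = Suc (Suc p)" "set xs \<subseteq> C" for xs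
  proof -
    have "xs \<in> AS_simplices (Suc p) (top_of_set C)" using that by (simp add: AS_simplices_def)
    then show ?thesis
      using fun_cong[OF eq, of xs] by (simp add: AS_pullback_def AS_coboundary_conv_face_sum)
  qed
  have "\<exists>e>0. (\<forall>ys. length ys = Suc (Suc (Suc p)) \<longrightarrow> set ys \<subseteq> ball x e \<longrightarrow> face_sum ys \<phi> = 0) \<and>
      (\<forall>xs. set xs \<subseteq> C \<inter> ball x e \<longrightarrow> \<theta> xs = 0)" if x: "x \<in> C" for x
  proof -
    obtain U where U: "open U" "x \<in> U"
        "\<And>ys. length ys = Suc (Suc (Suc p)) \<Longrightarrow> set ys \<subseteq> U \<Longrightarrow> face_sum ys \<phi> = 0"
      using AS_cocycles_locally_closed[OF \<phi>, of x] by auto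
    obtain V where V: "openin (top_of_set C) V" "x \<in> V" "\<And>xs. set xs \<subseteq> V \<Longrightarrow> \<theta> xs = 0"
      using AS_locally_zeroD[OF \<theta>, of x] x by auto
    obtain W where W: "open W" "V = C \<inter> W" using V(1) by (auto simp: openin_open)
    have "open (U \<inter> W)" "x \<in> U \<inter> W" using U V W by auto
    then obtain e where "0 < e" "ball x e \<subseteq> U \<inter> W" by (meson openE)
    then show ?thesis using U(3) V(3) W(2) by (intro exI[of _ e]) blast
  qed
  then obtain e where e: "\<And>x. x \<in> C \<Longrightarrow> 0 < e x"
      "\<And>x ys. x \<in> C \<Longrightarrow> length ys = Suc (Suc (Suc p)) \<Longrightarrow> set ys \<subseteq> ball x (e x) \<Longrightarrow> face_sum ys \<phi> = 0"
      "\<And>x xs. x \<in> C \<Longrightarrow> set xs \<subseteq> C \<inter> ball x (e x) \<Longrightarrow> \<theta> xs = 0"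
    by metis
  \<comment> \<open>The projection moves a point within \<open>e x / 4\<close> of \<open>x\<close> by at most \<open>e x / 2\<close>, so it stays in the ball of
    radius \<open>e x\<close>. The distance to \<open>C\<close> need not be attained, whence the factor 2 below.\<close>
  define N where "N = (\<Union>x\<in>C. ball x (e x / 4))"
  have "\<exists>c\<in>C. dist z c \<le> 2 * infdist z C" if "z \<in> N" for z
  proof -
    have ne: "C \<noteq> {}" using that by (auto simp: N_def)
    show ?thesis
    proof (cases "z \<in> C")
      case False
      then have "infdist z C < 2 * infdist z C"
        using infdist_pos_not_in_closed[OF C ne False] by simp
      then show ?thesis
        using cInf_lessD[of "dist z ` C" "2 * infdist z C"] ne
        by (auto simp: infdist_notempty intro: less_imp_le)
    qed (auto intro: bexI[of _ z] simp: infdist_nonneg)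
  qed
  then obtain r where r: "\<And>z. z \<in> N \<Longrightarrow> r z \<in> C" "\<And>z. z \<in> N \<Longrightarrow> dist z (r z) \<le> 2 * infdist z C"
    by metis
  have near: "z \<in> ball x (e x) \<and> r z \<in> ball x (e x)" if "x \<in> C" "z \<in> ball x (e x / 4)" for x z
  proof -
    have "z \<in> N" using that by (auto simp: N_def)
    then have "dist z (r z) \<le> 2 * dist z x"
      using r(2) infdist_le[OF that(1), of z] by fastforce
    moreover have "dist x z < e x / 4" using that(2) by simp
    moreover have "dist x z < e x" using calculation zero_le_dist[of x z] by linarith
    ultimately show ?thesis using dist_triangle[of x "r z" z]
      unfolding mem_ball dist_commute[of z x] by linarith
  qed
  have N: "\<exists>x\<in>C. openin (top_of_set N) (ball x (e x / 4)) \<and> z \<in> ball x (e x / 4)" if z: "z \<in> N" for z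
  proof -
    obtain x where x: "x \<in> C" "z \<in> ball x (e x / 4)" using z unfolding N_def by blast
    then have "ball x (e x / 4) \<subseteq> N" unfolding N_def by blast
    then have "openin (top_of_set N) (ball x (e x / 4))"
      by (simp add: openin_open) blast
    then show ?thesis using x by blast
  qed
  define g where "g j = (if j = 0 then id else r)" for j :: nat
  have 1: "AS_pullback (Suc p) (top_of_set N) (g 0) \<phi> - AS_pullback (Suc p) (top_of_set N) r \<phi>
      \<in> AS_coboundaries (Suc p) (top_of_set N)"
  proof (rule AS_pullback_small_steps[where J = "\<lambda>_. 1"])
    fix z assume "z \<in> topspace (top_of_set N)"
    then obtain x where x: "x \<in> C" "openin (top_of_set N) (ball x (e x / 4))" "z \<in> ball x (e x / 4)"
      using N by auto
    have "g j ` ball x (e x / 4) \<subseteq> ball x (e x)" for j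
      using near[OF x(1)] by (auto simp: g_def simp del: mem_ball)
    then show "\<exists>U. openin (top_of_set N) U \<and> z \<in> U \<and>
        (\<forall>j ys. length ys = Suc (Suc (Suc p)) \<longrightarrow> set ys \<subseteq> g j ` U \<union> g (Suc j) ` U \<longrightarrow> face_sum ys \<phi> = 0)"
      using x e(2)[OF x(1)] by (meson Un_least subset_trans)
  qed (simp add: g_def)
  have 2: "AS_pullback (Suc p) (top_of_set N) r \<phi> \<in> AS_coboundaries (Suc p) (top_of_set N)"
  proof -
    define \<psi>' where "\<psi>' = AS_pullback p (top_of_set N) r \<psi>"
    define \<theta>' where "\<theta>' = AS_pullback (Suc p) (top_of_set N) r \<theta>"
    have pull: "AS_pullback (Suc p) (top_of_set N) r \<phi> = AS_coboundary p (top_of_set N) \<psi>' + \<theta>'"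
    proof
      fix xs
      show "AS_pullback (Suc p) (top_of_set N) r \<phi> xs = (AS_coboundary p (top_of_set N) \<psi>' + \<theta>') xs"
      proof (cases "xs \<in> AS_simplices (Suc p) (top_of_set N)")
        case True
        then have len: "length xs = Suc (Suc p)" and xs: "set xs \<subseteq> N" by (auto simp: AS_simplices_def)
        have "face_sum xs \<psi>' = face_sum xs (\<lambda>ys. \<psi> (map r ys))"
          by (rule face_sum_cong) (use len xs in \<open>auto simp: \<psi>'_def AS_pullback_def AS_simplices_def\<close>)
        moreover have "\<phi> (map r xs) = face_sum (map r xs) \<psi> + \<theta> (map r xs)"
          by (rule \<phi>_C) (use len xs r(1) in auto)
        ultimately show ?thesis
          using True by (simp add: AS_pullback_def \<theta>'_def AS_coboundary_conv_face_sum face_sum_map)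
      qed (simp add: AS_pullback_def AS_coboundary_def \<theta>'_def)
    qed
    have "\<theta>' \<in> AS_locally_zero (Suc p) (top_of_set N)"
      unfolding \<theta>'_def
    proof (rule AS_locally_zeroI[OF AS_pullback_cochain])
      fix z assume "z \<in> topspace (top_of_set N)"
      then obtain x where x: "x \<in> C" "openin (top_of_set N) (ball x (e x / 4))" "z \<in> ball x (e x / 4)"
        using N by auto
      have "\<theta> (map r xs) = 0" if xs: "set xs \<subseteq> ball x (e x / 4)" for xs
      proof (rule e(3)[OF x(1)])
        show "set (map r xs) \<subseteq> C \<inter> ball x (e x)"
        proof
          fix w assume "w \<in> set (map r xs)"
          then obtain z where z: "w = r z" "z \<in> ball x (e x / 4)" using xs by auto
          then have "z \<in> N" using x(1) unfolding N_def by blast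
          then show "w \<in> C \<inter> ball x (e x)" using z near[OF x(1) z(2)] r(1) by blast
        qed
      qed
      then show "\<exists>U. openin (top_of_set N) U \<and> z \<in> U \<and> (\<forall>xs\<in>AS_simplices (Suc p) (top_of_set N).
          set xs \<subseteq> U \<longrightarrow> AS_pullback (Suc p) (top_of_set N) r \<theta> xs = 0)"
        using x by (intro exI[of _ "ball x (e x / 4)"]) (auto simp: AS_pullback_def)
    qed
    moreover have "\<psi>' \<in> AS_cochains p (top_of_set N)" by (simp add: \<psi>'_def AS_pullback_cochain)
    ultimately show ?thesis
      using AS_coboundaries_SucI[of \<psi>' p "top_of_set N" \<theta>'] by (simp only: pull)
  qed
  have "AS_pullback (Suc p) (top_of_set N) (g 0) \<phi> \<in> AS_coboundaries (Suc p) (top_of_set N)"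
    using AS_coboundaries_add[OF 1 2] unfolding diff_add_cancel .
  then have "AS_pullback (Suc p) (top_of_set N) id \<phi> \<in> AS_coboundaries (Suc p) (top_of_set N)"
    by (simp add: g_def)
  moreover have "open N" unfolding N_def by auto
  moreover have "C \<subseteq> N" unfolding N_def using e(1) by force
  ultimately show thesis using that by blast
qed


section \<open>Cup products and open covers\<close>

text \<open>
  A cochain on \<open>U\<close> is zero on all simplices that leave \<open>U\<close>, so it is also a cochain on the whole
  space. Its two coboundaries agree on the simplices inside \<open>U\<close>, which contain all small simplices
  around the points of the open set \<open>U\<close>.
\<close>

lemma AS_coboundaries_extend_from_open:
  fixes \<phi> :: "'a list \<Rightarrow> 'r::ring"
  assumes U: "openin X U"
    and restr: "AS_pullback k (subtopology X U) id \<phi> \<in> AS_coboundaries k (subtopology X U)"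
  shows "\<exists>\<beta>\<in>AS_coboundaries k X. \<forall>x\<in>U. \<exists>W. openin X W \<and> x \<in> W \<and>
    (\<forall>xs\<in>AS_simplices k X. set xs \<subseteq> W \<longrightarrow> \<phi> xs = \<beta> xs)"
proof -
  have UX: "U \<subseteq> topspace X" using openin_subset[OF U] .
  have simp_U: "xs \<in> AS_simplices k (subtopology X U)" if "xs \<in> AS_simplices k X" "set xs \<subseteq> U" for xs k
    using that by (auto simp: AS_simplices_def)
  have loc: "\<exists>W. openin X W \<and> x \<in> W \<and> W \<subseteq> U \<and> (\<forall>xs. set xs \<subseteq> W \<longrightarrow> \<theta> xs = 0)"
    if \<theta>: "\<theta> \<in> AS_locally_zero k (subtopology X U)" and x: "x \<in> U" for \<theta> :: "'a list \<Rightarrow> 'r" and x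
  proof -
    have "x \<in> topspace (subtopology X U)" using x UX by auto
    from AS_locally_zeroD[OF \<theta> this] obtain W where
      W: "openin (subtopology X U) W" "x \<in> W" "\<And>xs. set xs \<subseteq> W \<Longrightarrow> \<theta> xs = 0" by metis
    then show ?thesis using openin_open_subtopology[OF U] by blast
  qed
  from restr show ?thesis
  proof (cases rule: AS_coboundariesE)
    case 1
    show ?thesis
    proof (intro bexI[of _ 0] ballI)
      show "0 \<in> AS_coboundaries k X" by (simp add: AS_locally_zero_coboundaries AS_locally_zero_zero)
      fix x assume "x \<in> U"
      from loc[OF 1 this] obtain W where W: "openin X W" "x \<in> W" "W \<subseteq> U"
        "\<And>xs. set xs \<subseteq> W \<Longrightarrow> AS_pullback k (subtopology X U) id \<phi> xs = 0" by blast
      have "\<phi> xs = 0 xs" if "xs \<in> AS_simplices k X" "set xs \<subseteq> W" for xs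
        using W(4)[OF that(2)] simp_U[OF that(1)] that(2) W(3) by (simp add: AS_pullback_def)
      then show "\<exists>W. openin X W \<and> x \<in> W \<and> (\<forall>xs\<in>AS_simplices k X. set xs \<subseteq> W \<longrightarrow> \<phi> xs = 0 xs)"
        using W by blast
    qed
  next
    case (2 p \<psi> \<theta>)
    show ?thesis
    proof (intro bexI[of _ "AS_coboundary p X \<psi>"] ballI)
      have "\<psi> \<in> AS_cochains p X" using 2(2) by (auto simp: AS_cochains_def AS_simplices_def)
      then show "AS_coboundary p X \<psi> \<in> AS_coboundaries k X"
        unfolding 2(1) by (rule AS_coboundary_coboundaries)
      fix x assume "x \<in> U"
      from loc[OF 2(3) this] obtain W where W: "openin X W" "x \<in> W" "W \<subseteq> U"
        "\<And>xs. set xs \<subseteq> W \<Longrightarrow> \<theta> xs = 0" by blast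
      have "\<phi> xs = AS_coboundary p X \<psi> xs" if xs: "xs \<in> AS_simplices k X" "set xs \<subseteq> W" for xs
      proof -
        have xs': "xs \<in> AS_simplices k (subtopology X U)" using simp_U xs W(3) by blast
        have "\<phi> xs = AS_pullback k (subtopology X U) id \<phi> xs" using xs' by (simp add: AS_pullback_def)
        also have "\<dots> = AS_coboundary p (subtopology X U) \<psi> xs" using 2(4) W(4)[OF xs(2)] by simp
        also have "\<dots> = AS_coboundary p X \<psi> xs"
          using xs(1) xs' by (simp add: 2(1) AS_coboundary_conv_face_sum)
        finally show ?thesis .
      qed
      then show "\<exists>W. openin X W \<and> x \<in> W \<and>
          (\<forall>xs\<in>AS_simplices k X. set xs \<subseteq> W \<longrightarrow> \<phi> xs = AS_coboundary p X \<psi> xs)"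
        using W by blast
    qed
  qed
qed

text \<open>
  Changing \<open>\<phi>\<close> and \<open>\<psi>\<close> by coboundaries makes them vanish on the small simplices in \<open>U\<close> and in \<open>V\<close>
  respectively. Every small simplex lies in one of the two sets, and a face of a small simplex is
  small, so the product of the modified cocycles vanishes on small simplices.
\<close>

proposition AS_cup_open_cover:
  fixes \<phi> \<psi> :: "'a list \<Rightarrow> 'r::ring"
  assumes \<phi>: "\<phi> \<in> AS_cocycles k X" and \<psi>: "\<psi> \<in> AS_cocycles l X"
    and U: "openin X U" and V: "openin X V" and cover: "topspace X \<subseteq> U \<union> V"
    and \<phi>_U: "AS_pullback k (subtopology X U) id \<phi> \<in> AS_coboundaries k (subtopology X U)"
    and \<psi>_V: "AS_pullback l (subtopology X V) id \<psi> \<in> AS_coboundaries l (subtopology X V)"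
  shows "AS_cochain_cup k l X \<phi> \<psi> \<in> AS_coboundaries (k + l) X"
proof -
  obtain \<beta> where \<beta>: "\<beta> \<in> AS_coboundaries k X"
    "\<And>x. x \<in> U \<Longrightarrow> \<exists>W. openin X W \<and> x \<in> W \<and> (\<forall>xs\<in>AS_simplices k X. set xs \<subseteq> W \<longrightarrow> \<phi> xs = \<beta> xs)"
    using AS_coboundaries_extend_from_open[OF U \<phi>_U] by metis
  obtain \<gamma> where \<gamma>: "\<gamma> \<in> AS_coboundaries l X"
    "\<And>x. x \<in> V \<Longrightarrow> \<exists>W. openin X W \<and> x \<in> W \<and> (\<forall>xs\<in>AS_simplices l X. set xs \<subseteq> W \<longrightarrow> \<psi> xs = \<gamma> xs)"
    using AS_coboundaries_extend_from_open[OF V \<psi>_V] by metis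
  have "AS_cochain_cup k l X (\<phi> - \<beta>) (\<psi> - \<gamma>) \<in> AS_locally_zero (k + l) X"
  proof (rule AS_locally_zeroI[OF AS_cochain_cup_cochain])
    fix x assume "x \<in> topspace X"
    then have "x \<in> U \<or> x \<in> V" using cover by blast
    then obtain W where W: "openin X W" "x \<in> W" and
      disj: "(\<forall>xs\<in>AS_simplices k X. set xs \<subseteq> W \<longrightarrow> \<phi> xs = \<beta> xs) \<or>
             (\<forall>xs\<in>AS_simplices l X. set xs \<subseteq> W \<longrightarrow> \<psi> xs = \<gamma> xs)"
      using \<beta>(2)[of x] \<gamma>(2)[of x] by metis
    have "AS_cochain_cup k l X (\<phi> - \<beta>) (\<psi> - \<gamma>) xs = 0"
      if xs: "xs \<in> AS_simplices (k + l) X" "set xs \<subseteq> W" for xs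
    proof -
      have "take (Suc k) xs \<in> AS_simplices k X" "set (take (Suc k) xs) \<subseteq> W"
        using xs set_take_subset[of "Suc k" xs] by (auto simp: AS_simplices_def)
      moreover have "drop k xs \<in> AS_simplices l X" "set (drop k xs) \<subseteq> W"
        using xs set_drop_subset[of k xs] by (auto simp: AS_simplices_def)
      ultimately show ?thesis using disj by (auto simp: AS_cochain_cup_def)
    qed
    then show "\<exists>W. openin X W \<and> x \<in> W \<and> (\<forall>xs\<in>AS_simplices (k + l) X.
        set xs \<subseteq> W \<longrightarrow> AS_cochain_cup k l X (\<phi> - \<beta>) (\<psi> - \<gamma>) xs = 0)"
      using W by blast
  qed
  moreover have "\<psi> + - \<gamma> \<in> AS_cocycles l X"
    using \<psi> \<gamma>(1) AS_coboundaries_cocycles by (intro AS_cocycles_add AS_cocycles_uminus) auto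
  ultimately have "AS_cochain_cup k l X (\<phi> - \<beta>) (\<psi> - \<gamma>) +
      (AS_cochain_cup k l X \<beta> (\<psi> + - \<gamma>) + AS_cochain_cup k l X \<phi> \<gamma>) \<in> AS_coboundaries (k + l) X"
    by (intro AS_coboundaries_add AS_locally_zero_coboundaries
        AS_cup_coboundaries_left[OF \<beta>(1)] AS_cup_coboundaries_right[OF \<phi> \<gamma>(1)])
  also have "AS_cochain_cup k l X (\<phi> - \<beta>) (\<psi> - \<gamma>) +
      (AS_cochain_cup k l X \<beta> (\<psi> + - \<gamma>) + AS_cochain_cup k l X \<phi> \<gamma>) = AS_cochain_cup k l X \<phi> \<psi>"
    by (auto simp: AS_cochain_cup_def fun_eq_iff algebra_simps)
  finally show ?thesis .
qed


section \<open>Weights and supports in the Levy-Prokhorov metric\<close>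

lemma openin_fin_measure_space:
  "openin (fin_measure_space n) U \<longleftrightarrow> U \<subseteq> fin_measures n (UNIV :: 'a::metric_space set) \<and>
     (\<forall>p\<in>U. \<exists>e>0. \<forall>q\<in>fin_measures n UNIV. levy_prokhorov p q < e \<longrightarrow> q \<in> U)"
proof -
  interpret M: Metric_space "fin_measures n (UNIV :: 'a set)" levy_prokhorov
    by (rule Metric_space_levy_prokhorov)
  show ?thesis
    unfolding fin_measure_space_def M.openin_mtopology
  proof (rule conj_cong[OF refl])
    assume "U \<subseteq> fin_measures n UNIV"
    then have "M.mball p e \<subseteq> U \<longleftrightarrow> (\<forall>q\<in>fin_measures n UNIV. levy_prokhorov p q < e \<longrightarrow> q \<in> U)"
      if "p \<in> U" for p e
      using that by (auto simp: M.mball_def)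
    then show "(\<forall>p. p \<in> U \<longrightarrow> (\<exists>r>0. M.mball p r \<subseteq> U)) \<longleftrightarrow>
        (\<forall>p\<in>U. \<exists>e>0. \<forall>q\<in>fin_measures n UNIV. levy_prokhorov p q < e \<longrightarrow> q \<in> U)"
      by (simp add: Ball_def)
  qed
qed

lemma openin_levy_prokhorov_ball:
  "openin (fin_measure_space n) {q \<in> fin_measures n UNIV. levy_prokhorov p q < e}"
  unfolding openin_fin_measure_space
proof (intro conjI ballI)
  fix q assume "q \<in> {q \<in> fin_measures n UNIV. levy_prokhorov p q < e}"
  then have "levy_prokhorov p q < e" by simp
  moreover have "levy_prokhorov p q' < e" if "levy_prokhorov q q' < e - levy_prokhorov p q" for q'
    using levy_prokhorov_triangle[of p q' q] that by linarith
  ultimately show "\<exists>d>0. \<forall>q'\<in>fin_measures n UNIV. levy_prokhorov q q' < d \<longrightarrow>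
      q' \<in> {q \<in> fin_measures n UNIV. levy_prokhorov p q < e}"
    by (intro exI[of _ "e - levy_prokhorov p q"]) auto
qed auto

lemma fin_measures_mono: "m \<le> n \<Longrightarrow> fin_measures m Z \<subseteq> fin_measures n Z"
  by (auto simp: fin_measures_def)

lemma continuous_map_fin_measure_space_inclusion:
  assumes "m \<le> n"
  shows "continuous_map (fin_measure_space m) (fin_measure_space n :: 'a::metric_space pmf topology) id"
  unfolding continuous_map_def
proof (intro conjI allI impI)
  show "id \<in> topspace (fin_measure_space m) \<rightarrow> topspace (fin_measure_space n)"
    using fin_measures_mono[OF assms, of UNIV] by auto
  fix U :: "'a pmf set" assume U: "openin (fin_measure_space n) U"
  have "\<exists>e>0. \<forall>q\<in>fin_measures m UNIV. levy_prokhorov p q < e \<longrightarrow> q \<in> U" if "p \<in> U" for p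
    using U that fin_measures_mono[OF assms, of "UNIV :: 'a set"]
    unfolding openin_fin_measure_space by (meson subsetD)
  then show "openin (fin_measure_space m) {p \<in> topspace (fin_measure_space m). id p \<in> U}"
    unfolding openin_fin_measure_space by auto
qed

lemma continuous_map_from_fin_measures:
  assumes "\<And>p. p \<in> fin_measures n UNIV \<Longrightarrow> p \<in> S \<Longrightarrow> f p \<in> topspace Y"
    and "\<And>p V. p \<in> fin_measures n UNIV \<Longrightarrow> p \<in> S \<Longrightarrow> openin Y V \<Longrightarrow> f p \<in> V \<Longrightarrow>
      \<exists>e>0. \<forall>q\<in>fin_measures n UNIV \<inter> S. levy_prokhorov p q < e \<longrightarrow> f q \<in> V"
  shows "continuous_map (subtopology (fin_measure_space n) S) Y f"
  unfolding continuous_map_eq_topcontinuous_at topcontinuous_at_def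
proof (intro ballI conjI allI impI)
  fix p assume "p \<in> topspace (subtopology (fin_measure_space n) S)"
  then have p: "p \<in> fin_measures n UNIV" "p \<in> S" by auto
  show "p \<in> topspace (subtopology (fin_measure_space n) S)" using p by simp
  show "f \<in> topspace (subtopology (fin_measure_space n) S) \<rightarrow> topspace Y" using assms(1) by auto
  fix V assume "openin Y V \<and> f p \<in> V"
  then obtain e where e: "e > 0" "\<forall>q\<in>fin_measures n UNIV \<inter> S. levy_prokhorov p q < e \<longrightarrow> f q \<in> V"
    using assms(2)[OF p] by blast
  show "\<exists>U. openin (subtopology (fin_measure_space n) S) U \<and> p \<in> U \<and> (\<forall>q\<in>U. f q \<in> V)"
    using openin_subtopology_Int[OF openin_levy_prokhorov_ball[of n p e], of S] p e
    by (intro exI[of _ "{q \<in> fin_measures n UNIV. levy_prokhorov p q < e} \<inter> S"])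
      (auto simp: levy_prokhorov_same)
qed

lemma levy_prokhorov_less_ball:
  assumes "levy_prokhorov p q < e"
  shows "pmf p a \<le> measure_pmf.prob q (ball a e) + e"
  using levy_prokhorov_less[OF assms, of "{a}"] by (simp add: eps_nbhd_def measure_pmf_single)

lemma heavy_point_mem:
  assumes "pmf q b > 1 / 2" "measure_pmf.prob q A \<ge> 1 / 2"
  shows "b \<in> A"
proof (rule ccontr)
  assume "b \<notin> A"
  then have "measure_pmf.prob q (insert b A) = pmf q b + measure_pmf.prob q A"
    by (subst insert_is_Un, subst measure_pmf.finite_measure_Union) (auto simp: measure_pmf_single)
  then show False using measure_pmf.prob_le_1[of q "insert b A"] assms by linarith
qed

definition heavy_point :: "'a pmf \<Rightarrow> 'a" where
  "heavy_point p = (THE y. pmf p y > 1 / 2)"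

lemma heavy_point_eq: "pmf p y > 1 / 2 \<Longrightarrow> heavy_point p = y"
  unfolding heavy_point_def
proof (rule the_equality)
  fix z assume "pmf p y > 1 / 2" "pmf p z > 1 / 2"
  then have "z \<in> {y}" by (intro heavy_point_mem[of p z]) (simp_all add: measure_pmf_single)
  then show "z = y" by simp
qed

text \<open>
  A measure close to \<open>p\<close> puts at least half of its mass near the heavy point of \<open>p\<close>, which leaves
  too little mass elsewhere for a heavy point of its own.
\<close>

lemma continuous_map_heavy_point:
  "continuous_map (subtopology (fin_measure_space n) {p. \<exists>y. pmf p y > 1 / 2})
     (euclidean :: 'a::metric_space topology) heavy_point"
proof (rule continuous_map_from_fin_measures)
  fix p :: "'a pmf" and V
  assume "p \<in> {p. \<exists>y. pmf p y > 1 / 2}" and V: "openin euclidean V" "heavy_point p \<in> V"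
  then obtain y where y: "pmf p y > 1 / 2" by auto
  then have "y \<in> V" "open V" using V heavy_point_eq[OF y] by auto
  then obtain r where r: "r > 0" "ball y r \<subseteq> V" by (meson openE)
  define e where "e = min r (pmf p y - 1 / 2)"
  have "heavy_point q \<in> V" if q: "pmf q z > 1 / 2" and pq: "levy_prokhorov p q < e" for q z
  proof -
    have "1 / 2 \<le> measure_pmf.prob q (ball y e)"
      using levy_prokhorov_less_ball[OF pq, of y] unfolding e_def by linarith
    then have "z \<in> ball y e" using heavy_point_mem[OF q] by blast
    moreover have "ball y e \<subseteq> ball y r" by (rule subset_ball) (simp add: e_def)
    ultimately show ?thesis using r(2) heavy_point_eq[OF q] by blast
  qed
  then show "\<exists>e>0. \<forall>q\<in>fin_measures n UNIV \<inter> {p. \<exists>y. pmf p y > 1 / 2}.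
      levy_prokhorov p q < e \<longrightarrow> heavy_point q \<in> V"
    using r(1) y by (intro exI[of _ e]) (auto simp: e_def)
qed simp

lemma two_point_measureE:
  assumes "p \<in> fin_measures 2 UNIV"
  obtains a b where "set_pmf p = {a, b}"
proof -
  have c: "finite (set_pmf p)" "card (set_pmf p) \<le> 2" using assms by (auto simp: fin_measures_def)
  obtain a where a: "a \<in> set_pmf p" using set_pmf_not_empty[of p] by blast
  have "card (set_pmf p - {a}) \<le> 1" using c a by simp
  then consider "set_pmf p - {a} = {}" | b where "set_pmf p - {a} = {b}"
    using c(1) by (metis One_nat_def card_0_eq card_1_singletonE finite_Diff le_Suc_eq le_zero_eq)
  then show thesis using that a by cases blast+
qed

lemma pmf_two_points:
  assumes "set_pmf p = {a, b}" "a \<noteq> b"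
  shows "pmf p a + pmf p b = 1"
  using sum_pmf_eq_1[of "{a, b}" p] assms by simp

lemma prob_two_points:
  assumes "set_pmf p = {a, b}" "a \<noteq> b" "a \<in> A" "b \<notin> A"
  shows "measure_pmf.prob p A = pmf p a"
proof -
  have "measure_pmf.prob p A = measure_pmf.prob p (A \<inter> set_pmf p)" by (simp add: measure_Int_set_pmf)
  also have "A \<inter> set_pmf p = {a}" using assms by auto
  finally show ?thesis by (simp add: measure_pmf_single)
qed

text \<open>
  Both of the disjoint balls around \<open>a\<close> and \<open>b\<close> receive positive mass from \<open>q\<close>, and \<open>q\<close> has only two
  points to spend. The lower bounds for both weights then also bound them from above.
\<close>

lemma two_point_measure_split:
  fixes p q :: "'a::metric_space pmf"
  assumes p: "set_pmf p = {a, b}" "a \<noteq> b" and q: "q \<in> fin_measures 2 UNIV"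
    and pq: "levy_prokhorov p q < e"
    and e: "e \<le> dist a b / 2" "e \<le> pmf p a" "e \<le> pmf p b"
  obtains a' b' where "set_pmf q = {a', b'}" "a' \<noteq> b'" "a' \<in> ball a e" "b' \<in> ball b e"
    "\<bar>pmf q a' - pmf p a\<bar> < e"
proof -
  \<comment> \<open>The strict inequality leaves room for a smaller radius, so that both balls get positive mass.\<close>
  obtain d where d: "levy_prokhorov p q < d" "d < e" using dense[OF pq] by blast
  have sub: "ball x d \<subseteq> ball x e" for x :: 'a using d(2) by (intro subset_ball) simp
  have mass: "pmf p x - d \<le> measure_pmf.prob q (ball x d)" for x
    using levy_prokhorov_less_ball[OF d(1), of x] by linarith
  have ex: "\<exists>y\<in>set_pmf q. y \<in> ball x d" if "e \<le> pmf p x" for x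
  proof (rule ccontr)
    assume "\<not> ?thesis"
    then have "ball x d \<inter> set_pmf q = {}" by blast
    then have "measure_pmf.prob q (ball x d) = 0"
      using measure_Int_set_pmf[of q "ball x d"] by simp
    then show False using mass[of x] that d(2) by linarith
  qed
  obtain a' where a': "a' \<in> set_pmf q" "a' \<in> ball a d" using ex[OF e(2)] by blast
  obtain b' where b': "b' \<in> set_pmf q" "b' \<in> ball b d" using ex[OF e(3)] by blast
  have disj: "z \<notin> ball b d" if "z \<in> ball a d" for z
    using that e(1) d(2) dist_triangle[of a b z] by (auto simp: dist_commute)
  have ne: "a' \<noteq> b'" using disj a' b' by blast
  obtain u v where "set_pmf q = {u, v}" using two_point_measureE[OF q] .
  then have set_q: "set_pmf q = {a', b'}" using a'(1) b'(1) ne by auto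
  have "measure_pmf.prob q (ball a d) = pmf q a'" "measure_pmf.prob q (ball b d) = pmf q b'"
    using prob_two_points[OF set_q ne] prob_two_points[of q b' a'] set_q ne a' b' disj
    by (auto simp: insert_commute simp del: mem_ball)
  then have "\<bar>pmf q a' - pmf p a\<bar> < e"
    using mass[of a] mass[of b] pmf_two_points[OF set_q ne] pmf_two_points[OF p] d(2) by linarith
  then show thesis using that[OF set_q ne] a'(2) b'(2) sub by blast
qed

definition balanced :: "'a pmf \<Rightarrow> bool" where
  "balanced p \<longleftrightarrow> (\<forall>y. pmf p y \<in> {0, 1 / 2, 1})"

text \<open>
  An atom of another weight belongs to a measure with two distinct points, and by the preceding
  lemma nearby measures have two points with nearly the same weights. The converse direction fails,
  because measures with other weights can converge to a Dirac measure, which is balanced: the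
  balanced measures do not form an open set.
\<close>

lemma closedin_balanced:
  "closedin (fin_measure_space 2) {p \<in> fin_measures 2 (UNIV :: 'a::metric_space set). balanced p}"
  unfolding closedin_def
proof (intro conjI)
  have "\<exists>e>0. \<forall>q\<in>fin_measures 2 UNIV. levy_prokhorov p q < e \<longrightarrow> \<not> balanced q"
    if p: "p \<in> fin_measures 2 UNIV" "\<not> balanced p" for p :: "'a pmf"
  proof -
    obtain u v where uv: "set_pmf p = {u, v}" using two_point_measureE[OF p(1)] .
    obtain a where a: "pmf p a \<notin> {0, 1 / 2, 1}" using p(2) by (auto simp: balanced_def)
    then have "a \<in> set_pmf p" by (auto simp: set_pmf_iff)
    have uv': "u \<noteq> v"
    proof
      assume "u = v"
      then have "set_pmf p = {a}" using uv \<open>a \<in> set_pmf p\<close> by auto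
      then have "p = return_pmf a" using set_pmf_subset_singleton[of p a] by simp
      then show False using a by simp
    qed
    obtain b where b: "set_pmf p = {a, b}" "a \<noteq> b" using uv uv' \<open>a \<in> set_pmf p\<close> by auto
    have pos: "pmf p a > 0" "pmf p b > 0" using b(1) by (auto simp: pmf_positive)
    have sum1: "pmf p a + pmf p b = 1" by (rule pmf_two_points[OF b])
    define e where "e = min (min (dist a b / 2) \<bar>pmf p a - 1 / 2\<bar>) (min (pmf p a) (pmf p b))"
    have e: "e \<le> dist a b / 2" "e \<le> pmf p a" "e \<le> pmf p b" "e \<le> \<bar>pmf p a - 1 / 2\<bar>"
      unfolding e_def by linarith+
    have "e > 0" using b(2) pos a by (simp add: e_def)
    moreover have "\<not> balanced q" if q: "q \<in> fin_measures 2 UNIV" "levy_prokhorov p q < e" for q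
    proof -
      obtain a' b' where ab: "set_pmf q = {a', b'}" "a' \<noteq> b'" "\<bar>pmf q a' - pmf p a\<bar> < e"
        using two_point_measure_split[OF b q e(1-3)] by metis
      have "pmf q a' \<noteq> 1 / 2" using ab(3) e(4) by linarith
      moreover have "pmf q a' \<noteq> 0" "pmf q b' \<noteq> 0" using ab(1) by (auto simp: set_pmf_iff)
      moreover have "pmf q a' + pmf q b' = 1" by (rule pmf_two_points[OF ab(1,2)])
      ultimately have "pmf q a' \<notin> {0, 1 / 2, 1}" by auto
      then show ?thesis by (auto simp: balanced_def)
    qed
    ultimately show ?thesis by blast
  qed
  then show "openin (fin_measure_space 2)
      (topspace (fin_measure_space 2) - {p \<in> fin_measures 2 (UNIV :: 'a set). balanced p})"
    unfolding openin_fin_measure_space by auto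
qed auto

definition support_pair :: "'a pmf \<Rightarrow> 'a uprod" where
  "support_pair p = (THE u. set_uprod u = set_pmf p)"

lemma support_pair_eq: "set_pmf p = {a, b} \<Longrightarrow> support_pair p = Upair a b"
  unfolding support_pair_def
proof (rule the_equality)
  fix u assume "set_pmf p = {a, b}" "set_uprod u = set_pmf p"
  then show "u = Upair a b" by (cases u) (auto simp: doubleton_eq_iff)
qed simp

lemma support_pair_return [simp]: "support_pair (return_pmf x) = SP2_diagonal x"
  by (simp add: SP2_diagonal_def support_pair_eq)

text \<open>
  The support, as a point of the symmetric square, is not continuous on all measures with at most
  two points, because a point can lose its weight and disappear. On balanced measures it can only
  disappear by merging with the other point.
\<close>

lemma continuous_map_support_pair:
  "continuous_map (subtopology (fin_measure_space 2) {p. balanced p})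
     (SP2 (euclidean :: 'a::metric_space topology)) support_pair"
proof (rule continuous_map_from_fin_measures)
  fix p :: "'a pmf" assume "p \<in> fin_measures 2 UNIV"
  then obtain a b where ab: "set_pmf p = {a, b}" by (rule two_point_measureE)
  have "(case (a, b) of (x, y) \<Rightarrow> Upair x y) \<in> topspace (SP2 (euclidean :: 'a topology))"
    using quotient_imp_continuous_map[OF quotient_map_SP2[of "euclidean :: 'a topology"]]
    by (auto simp: continuous_map_def Pi_iff)
  then show "support_pair p \<in> topspace (SP2 (euclidean :: 'a topology))"
    by (simp add: support_pair_eq[OF ab])
next
  fix p :: "'a pmf" and V
  assume p: "p \<in> fin_measures 2 UNIV" "p \<in> {p. balanced p}"
    and V: "openin (SP2 euclidean) V" "support_pair p \<in> V"
  obtain a b where ab: "set_pmf p = {a, b}" using two_point_measureE[OF p(1)] .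
  let ?W = "{z. (case z of (x, y) \<Rightarrow> Upair x y) \<in> V}"
  have "openin (prod_topology euclidean euclidean) {z \<in> topspace (prod_topology euclidean euclidean).
      (case z of (x, y) \<Rightarrow> Upair x y) \<in> V}"
    by (rule openin_continuous_map_preimage[OF quotient_imp_continuous_map[OF quotient_map_SP2] V(1)])
  then have "open ?W" by (simp add: euclidean_product_topology)
  moreover have "(a, b) \<in> ?W" using V(2) by (simp add: support_pair_eq[OF ab])
  ultimately obtain A B where AB: "open A" "open B" "a \<in> A" "b \<in> B" "A \<times> B \<subseteq> ?W"
    by (auto elim!: open_prod_elim)
  obtain r where r: "r > 0" "ball a r \<subseteq> A" "ball b r \<subseteq> B"
  proof -
    obtain r1 r2 where "r1 > 0" "ball a r1 \<subseteq> A" "r2 > 0" "ball b r2 \<subseteq> B"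
      using AB by (meson openE)
    then show thesis by (intro that[of "min r1 r2"]) auto
  qed
  have UV: "Upair x y \<in> V" if "x \<in> ball a r" "y \<in> ball b r" for x y
  proof -
    have "(x, y) \<in> A \<times> B" using that r by blast
    then have "(x, y) \<in> ?W" using AB(5) by blast
    then show ?thesis by simp
  qed
  show "\<exists>e>0. \<forall>q\<in>fin_measures 2 UNIV \<inter> {p. balanced p}. levy_prokhorov p q < e \<longrightarrow> support_pair q \<in> V"
  proof (cases "a = b")
    case True
    then have "p = return_pmf a" using ab set_pmf_subset_singleton[of p a] by simp
    then have pa: "pmf p a = 1" by simp
    define e where "e = min r (1 / 4)"
    have "support_pair q \<in> V"
      if q: "q \<in> fin_measures 2 UNIV" "balanced q" and pq: "levy_prokhorov p q < e" for q
    proof -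
      obtain u v where uv: "set_pmf q = {u, v}" using two_point_measureE[OF q(1)] .
      have mass: "measure_pmf.prob q (ball a e) > 1 / 2"
        using levy_prokhorov_less_ball[OF pq, of a] pa unfolding e_def by linarith
      have "z \<in> ball a e" if z: "z \<in> set_pmf q" for z
      proof (rule ccontr)
        assume "z \<notin> ball a e"
        then have "measure_pmf.prob q (insert z (ball a e)) = pmf q z + measure_pmf.prob q (ball a e)"
          by (subst insert_is_Un, subst measure_pmf.finite_measure_Union) (auto simp: measure_pmf_single)
        moreover have "pmf q z \<ge> 1 / 2" using q(2) z by (auto simp: balanced_def set_pmf_iff dest: spec[of _ z])
        ultimately show False
          using mass measure_pmf.prob_le_1[of q "insert z (ball a e)"] by linarith
      qed
      moreover have "ball a e \<subseteq> ball a r" by (rule subset_ball) (simp add: e_def)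
      ultimately have "u \<in> ball a r" "v \<in> ball b r" using uv True by blast+
      then show ?thesis unfolding support_pair_eq[OF uv] by (rule UV)
    qed
    moreover have "e > 0" using r(1) by (simp add: e_def)
    ultimately show ?thesis by blast
  next
    case False
    have pos: "pmf p a > 0" "pmf p b > 0" using ab by (auto simp: pmf_positive)
    define e where "e = min (min (dist a b / 2) r) (min (pmf p a) (pmf p b))"
    have e: "e \<le> dist a b / 2" "e \<le> pmf p a" "e \<le> pmf p b" "e \<le> r"
      unfolding e_def by linarith+
    have "support_pair q \<in> V" if q: "q \<in> fin_measures 2 UNIV" "levy_prokhorov p q < e" for q
    proof -
      obtain a' b' where ab': "set_pmf q = {a', b'}" "a' \<in> ball a e" "b' \<in> ball b e"
        using two_point_measure_split[OF ab False q e(1-3)] by metis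
      have "ball x e \<subseteq> ball x r" for x :: 'a by (rule subset_ball) (rule e(4))
      then show ?thesis using ab'(2,3) UV unfolding support_pair_eq[OF ab'(1)] by blast
    qed
    moreover have "e > 0" using r(1) pos False by (simp add: e_def)
    ultimately show ?thesis by blast
  qed
qed


section \<open>Evaluating a map into a path space\<close>

text \<open>
  If \<open>H w t\<close> lies in an open set \<open>V\<close>, then \<open>H w\<close> maps a compact neighbourhood \<open>K\<close> of \<open>t\<close> into \<open>V\<close>, and in
  the compact-open topology this remains true for all maps near \<open>H w\<close>.
\<close>

lemma continuous_map_uncurry_compact_open:
  assumes X: "locally_compact_space X" "Hausdorff_space X"
    and H: "continuous_map W (compact_open_topology X Z) H"
  shows "continuous_map (prod_topology X W) Z (\<lambda>(t, w). H w t)"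
  unfolding continuous_map_eq_topcontinuous_at topcontinuous_at_def
proof (intro ballI conjI allI impI)
  have cont: "continuous_map X Z (H w)" if "w \<in> topspace W" for w
    using continuous_map_image_subset_topspace[OF H] that
    by (auto simp: topspace_compact_open_topology)
  show "(\<lambda>(t, w). H w t) \<in> topspace (prod_topology X W) \<rightarrow> topspace Z"
    using cont by (fastforce dest: continuous_map_image_subset_topspace)
  fix z assume z: "z \<in> topspace (prod_topology X W)"
  then show "z \<in> topspace (prod_topology X W)" .
  obtain t w where tw: "z = (t, w)" "t \<in> topspace X" "w \<in> topspace W" using z by auto
  fix V assume V: "openin Z V \<and> (case z of (t, w) \<Rightarrow> H w t) \<in> V"
  have "openin X {t \<in> topspace X. H w t \<in> V}" "t \<in> {t \<in> topspace X. H w t \<in> V}"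
    using openin_continuous_map_preimage[OF cont[OF tw(3)]] V tw by auto
  moreover have "neighbourhood_base_of (compactin X) X"
    using X locally_compact_space_neighbourhood_base by blast
  ultimately obtain U K where K: "openin X U" "compactin X K" "t \<in> U" "U \<subseteq> K"
      "K \<subseteq> {t \<in> topspace X. H w t \<in> V}"
    unfolding neighbourhood_base_of by meson
  let ?S = "{f \<in> extensional (topspace X). continuous_map X Z f \<and> f ` K \<subseteq> V}"
  have "openin (compact_open_topology X Z) ?S"
    unfolding compact_open_topology_def using K(2) V by (intro topology_generated_by_Basis) blast
  then have "openin W {w \<in> topspace W. H w \<in> ?S}"
    by (rule openin_continuous_map_preimage[OF H])
  moreover have "w \<in> {w \<in> topspace W. H w \<in> ?S}"
    using continuous_map_image_subset_topspace[OF H] tw(3) K(5)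
    by (auto simp: topspace_compact_open_topology)
  ultimately show "\<exists>U. openin (prod_topology X W) U \<and> z \<in> U \<and> (\<forall>y\<in>U. (case y of (t, w) \<Rightarrow> H w t) \<in> V)"
    using K(1,3,4) tw(1)
    by (intro exI[of _ "U \<times> {w \<in> topspace W. H w \<in> ?S}"]) (auto simp: openin_prod_Times_iff)
qed


section \<open>The heavy branch and the balanced part\<close>

text \<open>
  This is where resolvability enters. The weights of a resolvable path are carried by its branches.
  If the value at one time has an atom of weight other than \<open>0\<close>, \<open>1/2\<close> and \<open>1\<close>, then one of the two
  branches carries more than half of the mass, and it does so at all times.
\<close>

lemma resolver_heavy_branch:
  assumes \<mu>: "\<mu> \<in> fin_measures 2 Z" and t: "t \<in> {0..1}" and t': "t' \<in> {0..1}"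
    and unbalanced: "\<not> balanced (resolver \<mu> t)"
  shows "\<exists>y. pmf (resolver \<mu> t') y > 1 / 2"
proof -
  have "\<mu> \<in> fin_measures 2 UNIV" using \<mu> by (auto simp: fin_measures_def)
  then obtain \<alpha> \<beta> where ab: "set_pmf \<mu> = {\<alpha>, \<beta>}" by (rule two_point_measureE)
  have heavy: "\<exists>\<gamma>. pmf \<mu> \<gamma> > 1 / 2"
  proof (cases "\<alpha> = \<beta>")
    case True
    then have "\<mu> = return_pmf \<alpha>" using ab set_pmf_subset_singleton[of \<mu> \<alpha>] by simp
    then show ?thesis by (intro exI[of _ \<alpha>]) simp
  next
    case False
    note sum1 = pmf_two_points[OF ab False]
    show ?thesis
    proof (rule ccontr)
      assume "\<not> ?thesis"
      then have "pmf \<mu> \<alpha> \<le> 1 / 2" "pmf \<mu> \<beta> \<le> 1 / 2" by (simp_all add: not_less)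
      then have half: "pmf \<mu> \<alpha> = 1 / 2" "pmf \<mu> \<beta> = 1 / 2" using sum1 by linarith+
      have "pmf (resolver \<mu> t) y \<in> {0, 1 / 2, 1}" for y
      proof -
        have "pmf (resolver \<mu> t) y = measure_pmf.prob \<mu> ({\<alpha>, \<beta>} \<inter> (\<lambda>\<gamma>. \<gamma> t) -` {y})"
          using t measure_Int_set_pmf[of \<mu> "(\<lambda>\<gamma>. \<gamma> t) -` {y}"]
          by (simp add: resolver_def pmf_map ab Int_commute)
        also have "\<dots> = sum (pmf \<mu>) ({\<alpha>, \<beta>} \<inter> (\<lambda>\<gamma>. \<gamma> t) -` {y})"
          by (rule measure_measure_pmf_finite) simp
        finally have "pmf (resolver \<mu> t) y = \<dots>" .
        moreover have "{\<alpha>, \<beta>} \<inter> (\<lambda>\<gamma>. \<gamma> t) -` {y} \<in> {{}, {\<alpha>}, {\<beta>}, {\<alpha>, \<beta>}}" by auto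
        ultimately show ?thesis using half False by auto
      qed
      then show False using unbalanced by (simp add: balanced_def)
    qed
  qed
  then obtain \<gamma> where \<gamma>: "pmf \<mu> \<gamma> > 1 / 2" ..
  have "pmf \<mu> \<gamma> \<le> measure_pmf.prob \<mu> ((\<lambda>\<gamma>. \<gamma> t') -` {\<gamma> t'})"
    unfolding measure_pmf_single[symmetric] by (intro measure_pmf.finite_measure_mono) auto
  also have "\<dots> = pmf (resolver \<mu> t') (\<gamma> t')" using t' by (simp add: resolver_def pmf_map)
  finally show ?thesis using \<gamma> by (intro exI[of _ "\<gamma> t'"]) linarith
qed

lemma AS_pullback_AS_pullback_id:
  assumes "S \<subseteq> topspace X"
  shows "AS_pullback q (subtopology X S) id (AS_pullback q X f \<phi>) = AS_pullback q (subtopology X S) f \<phi>"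
  using assms by (auto simp: AS_pullback_def AS_simplices_def fun_eq_iff)

text \<open>
  The unbalanced points are contracted in \<open>X\<close> by following the heavy branch; the balanced
  points are contracted in the symmetric square, starting from the diagonal, by following both
  branches. The balanced points need not form an open set, and tautness enlarges them to one.
\<close>

proposition AS_cup_SP2_diagonal_coboundary:
  fixes x0 :: "'a::metric_space" and H :: "'a \<Rightarrow> real \<Rightarrow> 'a pmf"
    and \<phi> \<psi> :: "'a uprod list \<Rightarrow> 'r::ring"
  assumes n: "n \<le> 2" and H: "continuous_map euclidean (based_resolvable_space n x0) H"
    and H0: "\<And>x. H x 0 = return_pmf x"
    and \<phi>: "\<phi> \<in> AS_cocycles (Suc k) (SP2 euclidean)" and \<psi>: "\<psi> \<in> AS_cocycles (Suc l) (SP2 euclidean)"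
  shows "AS_cochain_cup (Suc k) (Suc l) euclidean (AS_pullback (Suc k) euclidean SP2_diagonal \<phi>)
     (AS_pullback (Suc l) euclidean SP2_diagonal \<psi>) \<in> AS_coboundaries (Suc k + Suc l) euclidean"
proof -
  have res: "\<exists>\<mu>\<in>fin_measures 2 UNIV. H x = resolver \<mu>" and H1: "H x 1 = return_pmf x0"
    and Hpath: "continuous_map euclidean (path_space (fin_measure_space n)) H" for x
  proof -
    show "continuous_map euclidean (path_space (fin_measure_space n)) H"
      using H unfolding based_resolvable_space_def by (rule continuous_map_into_fulltopology)
    have "H x \<in> {f \<in> resolvable_paths n. f 1 = return_pmf x0}"
      using continuous_map_image_subset_topspace[OF H] by (auto simp: based_resolvable_space_def)
    then show "H x 1 = return_pmf x0" and "\<exists>\<mu>\<in>fin_measures 2 UNIV. H x = resolver \<mu>"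
      using n by (auto simp: resolvable_paths_def fin_measures_def)
  qed
  have "continuous_map (prod_topology (top_of_set {0..1}) euclidean) (fin_measure_space n) (\<lambda>(t, x). H x t)"
    by (rule continuous_map_uncurry_compact_open[OF _ _ Hpath])
      (auto intro!: compact_imp_locally_compact_space Hausdorff_space_subtopology compact_space_subtopology)
  from continuous_map_compose[OF this continuous_map_fin_measure_space_inclusion[OF n]]
  have ev: "continuous_map (prod_topology (top_of_set {0..1}) euclidean) (fin_measure_space 2) (\<lambda>(t, x). H x t)"
    by simp
  define C where "C = {x. \<forall>t\<in>{0..1}. balanced (H x t)}"
  have ev_on: "continuous_map (prod_topology (top_of_set {0..1}) (top_of_set S))
      (subtopology (fin_measure_space 2) P) (\<lambda>(t, x). H x t)"
    if "\<And>x t. x \<in> S \<Longrightarrow> t \<in> {0..1} \<Longrightarrow> H x t \<in> P" for S P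
  proof -
    have "prod_topology (top_of_set {0..1::real}) (top_of_set S) =
        subtopology (prod_topology (top_of_set {0..1}) euclidean) (UNIV \<times> S)"
      by (simp only: subtopology_Times subtopology_UNIV)
    then have "continuous_map (prod_topology (top_of_set {0..1}) (top_of_set S)) (fin_measure_space 2)
        (\<lambda>(t, x). H x t)"
      using continuous_map_from_subtopology[OF ev, of "UNIV \<times> S"] by (simp only:)
    moreover have "(\<lambda>(t, x). H x t) \<in> topspace (prod_topology (top_of_set {0..1}) (top_of_set S)) \<rightarrow> P"
      using that by auto
    ultimately show ?thesis unfolding continuous_map_in_subtopology by blast
  qed
  have in2: "H x t \<in> fin_measures 2 UNIV" if "t \<in> {0..1}" for x t
    using funcset_mem[OF continuous_map_funspace[OF ev], of "(t, x)"] that by simp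
  have "closed C"
  proof -
    have "C = (\<Inter>t\<in>{0..1}. {x \<in> topspace euclidean. H x t \<in> {p \<in> fin_measures 2 UNIV. balanced p}})"
      using in2 by (auto simp: C_def)
    moreover have "closedin euclidean {x \<in> topspace euclidean. H x t \<in> {p \<in> fin_measures 2 UNIV. balanced p}}"
      if t: "t \<in> {0..1}" for t
    proof (rule closedin_continuous_map_preimage[OF _ closedin_balanced])
      have "continuous_map euclidean (prod_topology (top_of_set {0..1}) euclidean) (\<lambda>x. (t, x))"
        using t by (intro continuous_map_pairedI) auto
      from continuous_map_compose[OF this ev]
      show "continuous_map euclidean (fin_measure_space 2) (\<lambda>x. H x t)" by (simp add: o_def)
    qed
    ultimately show ?thesis by (simp add: closed_INT)
  qed
  have "AS_pullback (Suc k) (top_of_set C) SP2_diagonal \<phi> \<in> AS_coboundaries (Suc k) (top_of_set C)"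
  proof (rule AS_pullback_nullhomotopic[OF _ \<phi>, where h = "support_pair \<circ> (\<lambda>(t, x). H x t)"])
    show "continuous_map (prod_topology (top_of_set {0..1}) (top_of_set C)) (SP2 euclidean)
        (support_pair \<circ> (\<lambda>(t, x). H x t))"
      by (rule continuous_map_compose[OF ev_on continuous_map_support_pair]) (simp add: C_def)
    show "SP2_diagonal x0 \<in> topspace (SP2 (euclidean :: 'a topology))"
      using funcset_mem[OF continuous_map_funspace[OF continuous_map_SP2_diagonal], of x0 euclidean] by simp
  qed (simp_all add: H0 H1)
  then have "AS_pullback (Suc k) (top_of_set C) id (AS_pullback (Suc k) euclidean SP2_diagonal \<phi>)
      \<in> AS_coboundaries (Suc k) (top_of_set C)"
    by (simp add: AS_pullback_AS_pullback_id)
  then obtain N where N: "open N" "C \<subseteq> N"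
    "AS_pullback (Suc k) (top_of_set N) id (AS_pullback (Suc k) euclidean SP2_diagonal \<phi>)
      \<in> AS_coboundaries (Suc k) (top_of_set N)"
    using AS_coboundaries_closed_nbhd[OF \<open>closed C\<close> AS_pullback_cocycle[OF continuous_map_SP2_diagonal \<phi>]]
    by blast
  have "AS_pullback (Suc l) (top_of_set (- C)) id (AS_pullback (Suc l) euclidean SP2_diagonal \<psi>)
      \<in> AS_coboundaries (Suc l) (top_of_set (- C))"
  proof (rule AS_pullback_nullhomotopic[where h = "heavy_point \<circ> (\<lambda>(t, x). H x t)" and c = x0])
    have "\<exists>y. pmf (H x t) y > 1 / 2" if x: "x \<in> - C" and t: "t \<in> {0..1}" for x t
    proof -
      obtain t' where "t' \<in> {0..1}" "\<not> balanced (H x t')" using x by (auto simp: C_def)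
      moreover obtain \<mu> where "\<mu> \<in> fin_measures 2 UNIV" "H x = resolver \<mu>" using res by blast
      ultimately show ?thesis using resolver_heavy_branch t by metis
    qed
    then show "continuous_map (prod_topology (top_of_set {0..1}) (top_of_set (- C))) euclidean
        (heavy_point \<circ> (\<lambda>(t, x). H x t))"
      by (intro continuous_map_compose[OF ev_on continuous_map_heavy_point]) simp
  qed (use AS_pullback_cocycle[OF continuous_map_SP2_diagonal \<psi>] in \<open>simp_all add: H0 H1 heavy_point_eq\<close>)
  then show ?thesis
    using N \<open>closed C\<close>
    by (intro AS_cup_open_cover[where U = N and V = "- C"] AS_pullback_cocycle[OF continuous_map_SP2_diagonal] \<phi> \<psi>)
      auto
qed


text \<open>
  A witness for \<open>icat x0 \<le> 1\<close> takes values in the measures with at most two points, so by the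
  preceding proposition a representative of the cup product is a coboundary.
\<close>

theorem theorem7p8:
  fixes x0 :: "'a::metric_space"
    and \<alpha>1' \<alpha>2' :: "('a uprod list \<Rightarrow> 'r::ring) set"
    and \<alpha>1 \<alpha>2 :: "('a list \<Rightarrow> 'r) set"
    and k1 k2 :: nat
  assumes "path_connected (UNIV :: 'a set)"
    and "ANR_space (euclidean :: 'a topology)"
    and "k1 \<ge> 1" and "k2 \<ge> 1"
    and "\<alpha>1' \<in> carrier (AS_cohomology k1 (SP2 (euclidean :: 'a topology)))"
    and "\<alpha>2' \<in> carrier (AS_cohomology k2 (SP2 (euclidean :: 'a topology)))"
    and "\<alpha>1 = AS_induced k1 (euclidean :: 'a topology) SP2_diagonal \<alpha>1'"
    and "\<alpha>2 = AS_induced k2 (euclidean :: 'a topology) SP2_diagonal \<alpha>2'"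
    and "AS_cup k1 k2 (euclidean :: 'a topology) \<alpha>1 \<alpha>2
           \<noteq> \<one>\<^bsub>AS_cohomology (k1 + k2) (euclidean :: 'a topology)\<^esub>"
  shows "icat x0 \<ge> 2"
proof -
  obtain k l where kl: "k1 = Suc k" "k2 = Suc l" using assms(3,4) by (metis Suc_le_D One_nat_def)
  obtain \<phi> \<psi> where \<phi>: "\<phi> \<in> AS_cocycles k1 (SP2 euclidean)" "\<alpha>1' = AS_class k1 (SP2 euclidean) \<phi>"
    and \<psi>: "\<psi> \<in> AS_cocycles k2 (SP2 euclidean)" "\<alpha>2' = AS_class k2 (SP2 euclidean) \<psi>"
    using assms(5,6) unfolding carrier_AS_cohomology by blast
  let ?\<phi> = "AS_pullback k1 (euclidean :: 'a topology) SP2_diagonal \<phi>"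
  let ?\<psi> = "AS_pullback k2 (euclidean :: 'a topology) SP2_diagonal \<psi>"
  have cup: "AS_cup k1 k2 euclidean \<alpha>1 \<alpha>2 = AS_class (k1 + k2) euclidean (AS_cochain_cup k1 k2 euclidean ?\<phi> ?\<psi>)"
    unfolding assms(7,8) \<phi>(2) \<psi>(2) AS_induced_class[OF continuous_map_SP2_diagonal]
    by (intro AS_cup_class AS_pullback_cocycle[OF continuous_map_SP2_diagonal] \<phi> \<psi>)
  have "2 \<le> enat n"
    if H: "continuous_map euclidean (based_resolvable_space (n + 1) x0) H" "\<forall>x. H x 0 = return_pmf x"
    for n and H :: "'a \<Rightarrow> real \<Rightarrow> 'a pmf"
  proof (rule ccontr)
    assume "\<not> 2 \<le> enat n"
    then have "n + 1 \<le> 2" by (simp add: numeral_eq_enat)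
    then have "AS_cochain_cup k1 k2 euclidean ?\<phi> ?\<psi> \<in> AS_coboundaries (k1 + k2) euclidean"
      using AS_cup_SP2_diagonal_coboundary[OF _ H(1)] H(2) \<phi>(1) \<psi>(1) unfolding kl by blast
    then have "AS_class (k1 + k2) euclidean (AS_cochain_cup k1 k2 euclidean ?\<phi> ?\<psi>) =
        AS_class (k1 + k2) euclidean 0"
      by (intro AS_class_eq) simp
    also have "\<dots> = AS_coboundaries (k1 + k2) euclidean" by (auto simp: mem_AS_class)
    finally show False using assms(9) unfolding cup one_AS_cohomology by contradiction
  qed
  then show ?thesis unfolding icat_def by (intro Inf_greatest) auto
qed

end
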